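(* Let $n\ge2$ and $\ell\ge 1$ be integers. The image of $B_n[\ell]$ in $\mathrm{GL}_n(\mathbb{Z})$ under the integral Burau representation $\rho$ is as follows. (1) If $\ell$ is even or $n\in\{2,3\}$, the image is $\Gamma_{n-1}[\ell]$. (2) If $n\ge 4$ and $\ell$ is odd, the image is the preimage of $S_n\hookrightarrow \Gamma_{n-1}[\ell]/\Gamma_{n-1}[2\ell]$ along the quotient map $\Gamma_{n-1}[\ell]\to\Gamma_{n-1}[\ell]/\Gamma_{n-1}[2\ell]$.
   Context: $B_n$ is the braid group on $n$ strands with Artin generators $\sigma_1,\dots,\sigma_{n-1}$. The integral Burau representation $\rho\colon B_n\to \mathrm{GL}_n(\mathbb{Z})$ is the unreduced Burau representation at $t=-1$: $\rho(\sigma_i)$ is the block diagonal matrix with blocks $I_{i-1}$, $\begin{pmatrix}2&-1\\1&0\end{pmatrix}$, $I_{n-i-1}$. For $\ell\ge1$, $B_n[\ell]=\{b\in B_n\mid \rho(b)\equiv I_n \bmod \ell\}$. Equip $\mathbb{Z}^n$ (standard basis $e_1,\dots,e_n$) with the alternating bilinear form $\langle e_i,e_j\rangle=(-1)^{i+j+1}$ for $i<j$, $0$ for $i=j$, $(-1)^{i+j}$ for $i>j$. Let $v_n=e_1+\dots+e_n$ and $w_n=e_1-e_2+\dots+(-1)^{n-1}e_n$. Define \[\Gamma_{n-1}=\{A\in \mathrm{GL}_n(\mathbb{Z})\mid \langle Av,Aw\rangle=\langle v,w\rangle\ \forall v,w\in\mathbb{Z}^n,\ Av_n=v_n,\ w_n^TA=w_n^T\},\]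 \[\Gamma_{n-1}[\ell]=\{A\in\Gamma_{n-1}\mid A\equiv I_n \bmod \ell\}.\] (Up to isomorphism compatible with the congruence subgroups, $\Gamma_{2g}$ is $\mathrm{Sp}_{2g}(\mathbb{Z})$ and $\Gamma_{2g-1}$ is the stabilizer $[\mathrm{Sp}_{2g}(\mathbb{Z})]_{e_1}$ of the first standard basis vector.) The image of $\rho$ lies in $\Gamma_{n-1}$. For $\ell$ odd, the inclusion $\Gamma_{n-1}[\ell]\subset\Gamma_{n-1}$ induces an isomorphism $\Gamma_{n-1}[\ell]/\Gamma_{n-1}[2\ell]\cong\Gamma_{n-1}/\Gamma_{n-1}[2]$. The inclusion $S_n\hookrightarrow\Gamma_{n-1}[\ell]/\Gamma_{n-1}[2\ell]\cong\Gamma_{n-1}/\Gamma_{n-1}[2]$ is the one whose image is the image of $B_n$ in $\Gamma_{n-1}/\Gamma_{n-1}[2]$ under $\rho$; by Arnol'd, $B_n[2]$ is the pure braid group, so this image is $B_n/B_n[2]\cong S_n$. *)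

theory Defs
  imports "Jordan_Normal_Form.Matrix" "HOL-Algebra.Sym_Groups"
begin

section \<open>Braid groups\<close>

text \<open>The letter \<open>(i, True)\<close> is \<open>\<sigma>\<^sub>i\<close> and \<open>(i, False)\<close> is its inverse.\<close>

type_synonym braid_word = "(nat \<times> bool) list"

definition braid_words :: "nat \<Rightarrow> braid_word set" where
  "braid_words n = {w. \<forall>(i, b) \<in> set w. 1 \<le> i \<and> i < n}"

inductive braid_eq :: "nat \<Rightarrow> braid_word \<Rightarrow> braid_word \<Rightarrow> bool" for n :: nat where
  cancel: "\<lbrakk>1 \<le> i; i < n; u \<in> braid_words n; v \<in> braid_words n\<rbrakk>
    \<Longrightarrow> braid_eq n (u @ [(i, b), (i, \<not> b)] @ v) (u @ v)"
| far: "\<lbrakk>1 \<le> i; i + 1 < j; j < n; u \<in> braid_words n; v \<in> braid_words n\<rbrakk>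
    \<Longrightarrow> braid_eq n (u @ [(i, True), (j, True)] @ v) (u @ [(j, True), (i, True)] @ v)"
| adjacent: "\<lbrakk>1 \<le> i; i + 1 < n; u \<in> braid_words n; v \<in> braid_words n\<rbrakk>
    \<Longrightarrow> braid_eq n (u @ [(i, True), (i + 1, True), (i, True)] @ v)
                   (u @ [(i + 1, True), (i, True), (i + 1, True)] @ v)"
| refl: "w \<in> braid_words n \<Longrightarrow> braid_eq n w w"
| sym: "braid_eq n u v \<Longrightarrow> braid_eq n v u"
| trans: "braid_eq n u v \<Longrightarrow> braid_eq n v w \<Longrightarrow> braid_eq n u w"

definition braid_class :: "nat \<Rightarrow> braid_word \<Rightarrow> braid_word set" where
  "braid_class n w = {u. braid_eq n w u}"

definition braid_group :: "nat \<Rightarrow> braid_word set monoid" where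
  "braid_group n =
    \<lparr> carrier = braid_class n ` braid_words n,
      mult = (\<lambda>X Y. {w. \<exists>u\<in>X. \<exists>v\<in>Y. braid_eq n (u @ v) w}),
      one = braid_class n [] \<rparr>"

text \<open>Evaluation of words in a group, given the values \<open>f i\<close> of the generators.  If these satisfy
  the braid relations, \<open>braid_lift\<close> is the induced homomorphism on the braid group
  (see \<open>braid_lift_class\<close> and \<open>braid_lift_hom\<close> below).\<close>

primrec word_eval :: "('a, 'b) monoid_scheme \<Rightarrow> (nat \<Rightarrow> 'a) \<Rightarrow> braid_word \<Rightarrow> 'a" where
  "word_eval G f [] = \<one>\<^bsub>G\<^esub>"
| "word_eval G f (x # w) =
    (if snd x then f (fst x) else inv\<^bsub>G\<^esub> (f (fst x))) \<otimes>\<^bsub>G\<^esub> word_eval G f w"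

definition braid_lift :: "('a, 'b) monoid_scheme \<Rightarrow> (nat \<Rightarrow> 'a) \<Rightarrow> braid_word set \<Rightarrow> 'a" where
  "braid_lift G f X = the_elem (word_eval G f ` X)"

definition braid_perm :: "nat \<Rightarrow> braid_word set \<Rightarrow> nat \<Rightarrow> nat" where
  "braid_perm n = braid_lift (sym_group n) (\<lambda>i. transpose i (i + 1))"


section \<open>The integral Burau representation\<close>

definition GL :: "nat \<Rightarrow> int mat monoid" where
  "GL n = units_of (ring_mat TYPE(int) n ())"

definition burau_gen :: "nat \<Rightarrow> nat \<Rightarrow> int mat" where
  "burau_gen n i = diag_block_mat
    [1\<^sub>m (i - 1), mat_of_rows_list 2 [[2, -1], [1, 0]], 1\<^sub>m (n - i - 1)]"

definition burau :: "nat \<Rightarrow> braid_word set \<Rightarrow> int mat" where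
  "burau n = braid_lift (GL n) (burau_gen n)"

definition mat_cong :: "nat \<Rightarrow> int mat \<Rightarrow> int mat \<Rightarrow> bool" where
  "mat_cong l A B \<longleftrightarrow> dim_row A = dim_row B \<and> dim_col A = dim_col B \<and>
    (\<forall>i < dim_row A. \<forall>j < dim_col A. int l dvd A $$ (i, j) - B $$ (i, j))"

definition braid_cong :: "nat \<Rightarrow> nat \<Rightarrow> braid_word set set" where
  "braid_cong n l = {b \<in> carrier (braid_group n). mat_cong l (burau n b) (1\<^sub>m n)}"


section \<open>The group \<open>\<Gamma>\<^sub>n\<^sub>-\<^sub>1\<close> and its congruence subgroups\<close>

text \<open>Vector and matrix indices start at \<open>0\<close>.  This does not change the parity of \<open>i + j\<close>, but
  the \<open>i\<close>-th entry (from \<open>0\<close>) of \<open>w\<^sub>n\<close> becomes \<open>(-1)\<^sup>i\<close>.\<close>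

definition form_basis :: "nat \<Rightarrow> nat \<Rightarrow> int" where
  "form_basis i j = (if i < j then (-1) ^ (i + j + 1) else if i = j then 0 else (-1) ^ (i + j))"

definition alt_form :: "nat \<Rightarrow> int vec \<Rightarrow> int vec \<Rightarrow> int" where
  "alt_form n x y = (\<Sum>i<n. \<Sum>j<n. x $ i * y $ j * form_basis i j)"

definition v_vec :: "nat \<Rightarrow> int vec" where
  "v_vec n = vec n (\<lambda>i. 1)"

definition w_vec :: "nat \<Rightarrow> int vec" where
  "w_vec n = vec n (\<lambda>i. (-1) ^ i)"

text \<open>\<open>Gamma n\<close>, indexed by the size of the matrices, is the group usually written
  \<open>\<Gamma>\<^sub>n\<^sub>-\<^sub>1\<close>.\<close>

definition Gamma :: "nat \<Rightarrow> int mat set" where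
  "Gamma n = {A \<in> carrier (GL n).
    (\<forall>x \<in> carrier_vec n. \<forall>y \<in> carrier_vec n. alt_form n (A *\<^sub>v x) (A *\<^sub>v y) = alt_form n x y) \<and>
    A *\<^sub>v v_vec n = v_vec n \<and>
    mat_of_row (w_vec n) * A = mat_of_row (w_vec n)}"

definition Gamma_cong :: "nat \<Rightarrow> nat \<Rightarrow> int mat set" where
  "Gamma_cong n l = {A \<in> Gamma n. mat_cong l A (1\<^sub>m n)}"


section \<open>The symmetric group in the quotient of level \<open>2l\<close>\<close>

definition Gamma_quot :: "nat \<Rightarrow> nat \<Rightarrow> int mat set monoid" where
  "Gamma_quot n l = (GL n\<lparr>carrier := Gamma_cong n l\<rparr>) Mod Gamma_cong n (2 * l)"

text \<open>The map \<open>\<Gamma>[l]/\<Gamma>[2l] \<rightarrow> \<Gamma>/\<Gamma>[2]\<close> induced by the inclusion; it is an isomorphism if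
  \<open>l\<close> is odd.\<close>

definition quot_map :: "nat \<Rightarrow> int mat set \<Rightarrow> int mat set" where
  "quot_map n X = the_elem ((\<lambda>A. Gamma_cong n 2 #>\<^bsub>GL n\<^esub> A) ` X)"

text \<open>The embedding of \<open>S\<^sub>n = B\<^sub>n/PB\<^sub>n\<close> into \<open>\<Gamma>/\<Gamma>[2]\<close> induced by the Burau representation: a
  permutation is sent to the class of \<open>burau n b\<close> for any braid \<open>b\<close> inducing it
  (see \<open>sym_mod2_braid_perm\<close> below).\<close>

definition sym_mod2 :: "nat \<Rightarrow> (nat \<Rightarrow> nat) \<Rightarrow> int mat set" where
  "sym_mod2 n p = the_elem ((\<lambda>b. Gamma_cong n 2 #>\<^bsub>GL n\<^esub> burau n b) `
    {b \<in> carrier (braid_group n). braid_perm n b = p})"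

definition sym_incl :: "nat \<Rightarrow> nat \<Rightarrow> (nat \<Rightarrow> nat) \<Rightarrow> int mat set" where
  "sym_incl n l p = inv_into (carrier (Gamma_quot n l)) (quot_map n) (sym_mod2 n p)"

section \<open>Well-definedness of the constructions\<close>

subsection \<open>The braid group is a group\<close>

lemma braid_words_append [simp]:
  "u @ v \<in> braid_words n \<longleftrightarrow> u \<in> braid_words n \<and> v \<in> braid_words n"
  by (auto simp: braid_words_def)

lemma braid_words_Nil [simp]: "[] \<in> braid_words n"
  by (simp add: braid_words_def)

lemma braid_words_Cons [simp]:
  "(i, b) # w \<in> braid_words n \<longleftrightarrow> 1 \<le> i \<and> i < n \<and> w \<in> braid_words n"
  by (auto simp: braid_words_def)

lemma braid_eq_words: "braid_eq n u v \<Longrightarrow> u \<in> braid_words n \<and> v \<in> braid_words n"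
  by (induction rule: braid_eq.induct) auto

lemma braid_eq_context:
  "braid_eq n u v \<Longrightarrow> x \<in> braid_words n \<Longrightarrow> y \<in> braid_words n \<Longrightarrow>
    braid_eq n (x @ u @ y) (x @ v @ y)"
proof (induction rule: braid_eq.induct)
  case (cancel i u v b)
  then show ?case using braid_eq.cancel[of i n "x @ u" "v @ y" b] by simp
next
  case (far i j u v)
  then show ?case using braid_eq.far[of i j n "x @ u" "v @ y"] by simp
next
  case (adjacent i u v)
  then show ?case using braid_eq.adjacent[of i n "x @ u" "v @ y"] by simp
qed (auto intro: braid_eq.refl braid_eq.sym braid_eq.trans)

lemma braid_eq_append:
  assumes "braid_eq n u u'" and "braid_eq n v v'"
  shows "braid_eq n (u @ v) (u' @ v')"
  using braid_eq_context[OF assms(1), of "[]" v] braid_eq_context[OF assms(2), of u' "[]"]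
    braid_eq_words[OF assms(1)] braid_eq_words[OF assms(2)]
  by (auto intro: braid_eq.trans)

lemma braid_class_eq: "braid_eq n u v \<Longrightarrow> braid_class n u = braid_class n v"
  unfolding braid_class_def by (blast intro: braid_eq.sym braid_eq.trans)

lemma braid_class_mult:
  assumes "u \<in> braid_words n" and "v \<in> braid_words n"
  shows "braid_class n u \<otimes>\<^bsub>braid_group n\<^esub> braid_class n v = braid_class n (u @ v)"
proof -
  have "braid_eq n (u @ v) w" if "braid_eq n u u'" "braid_eq n v v'" "braid_eq n (u' @ v') w"
    for u' v' w
    using braid_eq_append[OF that(1,2)] that(3) by (rule braid_eq.trans)
  then show ?thesis
    unfolding braid_group_def braid_class_def using assms by (auto intro: braid_eq.refl)
qed

definition braid_word_inv :: "braid_word \<Rightarrow> braid_word" where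
  "braid_word_inv w = rev (map (\<lambda>(i, b). (i, \<not> b)) w)"

lemma braid_word_inv_words: "w \<in> braid_words n \<Longrightarrow> braid_word_inv w \<in> braid_words n"
  by (auto simp: braid_word_inv_def braid_words_def)

lemma braid_word_inv_left: "w \<in> braid_words n \<Longrightarrow> braid_eq n (braid_word_inv w @ w) []"
proof (induction w)
  case Nil
  then show ?case by (simp add: braid_word_inv_def braid_eq.refl)
next
  case (Cons x w)
  obtain i b where x: "x = (i, b)" by (cases x)
  have "braid_eq n (braid_word_inv w @ [(i, \<not> b), (i, \<not> \<not> b)] @ w) (braid_word_inv w @ w)"
    using Cons.prems x braid_word_inv_words by (intro braid_eq.cancel) auto
  with Cons x show ?case
    by (auto simp: braid_word_inv_def intro: braid_eq.trans)
qed

lemma carrier_braid_group: "carrier (braid_group n) = braid_class n ` braid_words n"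
  by (simp add: braid_group_def)

lemma one_braid_group: "\<one>\<^bsub>braid_group n\<^esub> = braid_class n []"
  by (simp add: braid_group_def)

lemma braid_group_is_group: "group (braid_group n)"
proof (rule groupI)
  fix x assume "x \<in> carrier (braid_group n)"
  then obtain u where u: "u \<in> braid_words n" "x = braid_class n u"
    by (auto simp: carrier_braid_group)
  then have "braid_class n (braid_word_inv u) \<otimes>\<^bsub>braid_group n\<^esub> x = \<one>\<^bsub>braid_group n\<^esub>"
    by (simp add: braid_class_mult braid_word_inv_words one_braid_group
        braid_class_eq[OF braid_word_inv_left])
  then show "\<exists>y\<in>carrier (braid_group n). y \<otimes>\<^bsub>braid_group n\<^esub> x = \<one>\<^bsub>braid_group n\<^esub>"
    using u braid_word_inv_words by (auto simp: carrier_braid_group)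
qed (auto simp: carrier_braid_group one_braid_group braid_class_mult)


subsection \<open>The homomorphism induced by a family satisfying the braid relations\<close>

definition braid_relations :: "('a, 'b) monoid_scheme \<Rightarrow> nat \<Rightarrow> (nat \<Rightarrow> 'a) \<Rightarrow> bool" where
  "braid_relations G n f \<longleftrightarrow>
    (\<forall>i. 1 \<le> i \<and> i < n \<longrightarrow> f i \<in> carrier G) \<and>
    (\<forall>i j. 1 \<le> i \<and> i + 1 < j \<and> j < n \<longrightarrow> f i \<otimes>\<^bsub>G\<^esub> f j = f j \<otimes>\<^bsub>G\<^esub> f i) \<and>
    (\<forall>i. 1 \<le> i \<and> i + 1 < n \<longrightarrow>
      f i \<otimes>\<^bsub>G\<^esub> (f (i + 1) \<otimes>\<^bsub>G\<^esub> f i) = f (i + 1) \<otimes>\<^bsub>G\<^esub> (f i \<otimes>\<^bsub>G\<^esub> f (i + 1)))"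

lemma braid_relationsD:
  assumes "braid_relations G n f"
  shows "1 \<le> i \<Longrightarrow> i < n \<Longrightarrow> f i \<in> carrier G"
    and "1 \<le> i \<Longrightarrow> i + 1 < j \<Longrightarrow> j < n \<Longrightarrow> f i \<otimes>\<^bsub>G\<^esub> f j = f j \<otimes>\<^bsub>G\<^esub> f i"
    and "1 \<le> i \<Longrightarrow> i + 1 < n \<Longrightarrow>
      f i \<otimes>\<^bsub>G\<^esub> (f (i + 1) \<otimes>\<^bsub>G\<^esub> f i) = f (i + 1) \<otimes>\<^bsub>G\<^esub> (f i \<otimes>\<^bsub>G\<^esub> f (i + 1))"
  using assms unfolding braid_relations_def by blast+

context group
begin

lemma word_eval_closed:
  "braid_relations G n f \<Longrightarrow> w \<in> braid_words n \<Longrightarrow> word_eval G f w \<in> carrier G"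
  by (induction w) (auto simp: braid_relations_def braid_words_def)

lemma word_eval_append:
  assumes f: "braid_relations G n f" and "u \<in> braid_words n" and v: "v \<in> braid_words n"
  shows "word_eval G f (u @ v) = word_eval G f u \<otimes> word_eval G f v"
  using assms(2)
proof (induction u)
  case Nil
  then show ?case using word_eval_closed[OF f v] by simp
next
  case (Cons x u)
  obtain i b where x: "x = (i, b)" by (cases x)
  have "f i \<in> carrier G" using Cons.prems x f by (auto simp: braid_relations_def)
  with Cons x word_eval_closed[OF f v] word_eval_closed[OF f, of u] show ?case
    by (auto simp: m_assoc)
qed

lemma word_eval_context:
  assumes f: "braid_relations G n f" and "word_eval G f x = word_eval G f y"
    and "u \<in> braid_words n" "v \<in> braid_words n" "x \<in> braid_words n" "y \<in> braid_words n"
  shows "word_eval G f (u @ x @ v) = word_eval G f (u @ y @ v)"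
  using assms by (simp add: word_eval_append[OF f])

lemma word_eval_braid_eq:
  assumes f: "braid_relations G n f" and "braid_eq n u v"
  shows "word_eval G f u = word_eval G f v"
  using assms(2)
proof (induction rule: braid_eq.induct)
  case (cancel i u v b)
  then have "f i \<in> carrier G" using f by (auto simp: braid_relations_def)
  then have "word_eval G f ([(i, b), (i, \<not> b)]) = \<one>" by auto
  with cancel show ?case
    using word_eval_context[OF f, of "[(i, b), (i, \<not> b)]" "[]" u v] by simp
next
  case (far i j u v)
  then have "f i \<in> carrier G" "f j \<in> carrier G" "f i \<otimes> f j = f j \<otimes> f i"
    using braid_relationsD(1)[OF f, of i] braid_relationsD(1)[OF f, of j]
      braid_relationsD(2)[OF f, of i j] by auto
  then have "word_eval G f [(i, True), (j, True)] = word_eval G f [(j, True), (i, True)]"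
    by simp
  then show ?case by (rule word_eval_context[OF f]) (use far.hyps in auto)
next
  case (adjacent i u v)
  then have "f i \<in> carrier G" "f (i + 1) \<in> carrier G"
    "f i \<otimes> (f (i + 1) \<otimes> f i) = f (i + 1) \<otimes> (f i \<otimes> f (i + 1))"
    using braid_relationsD(1)[OF f, of i] braid_relationsD(1)[OF f, of "i + 1"]
      braid_relationsD(3)[OF f, of i] by auto
  then have "word_eval G f [(i, True), (i + 1, True), (i, True)] =
      word_eval G f [(i + 1, True), (i, True), (i + 1, True)]"
    by (simp only: word_eval.simps snd_conv fst_conv if_True r_one)
  then show ?case by (rule word_eval_context[OF f]) (use adjacent.hyps in auto)
qed simp_all

lemma braid_lift_class:
  assumes f: "braid_relations G n f" and w: "w \<in> braid_words n"
  shows "braid_lift G f (braid_class n w) = word_eval G f w"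
proof -
  have "word_eval G f ` braid_class n w = {word_eval G f w}"
  proof (intro equalityI subsetI)
    fix x assume "x \<in> word_eval G f ` braid_class n w"
    then obtain u where "braid_eq n w u" "x = word_eval G f u"
      by (auto simp: braid_class_def)
    then show "x \<in> {word_eval G f w}" using word_eval_braid_eq[OF f] by simp
  qed (use braid_eq.refl[OF w] in \<open>auto simp: braid_class_def\<close>)
  then show ?thesis by (simp add: braid_lift_def)
qed

lemma braid_lift_hom:
  assumes f: "braid_relations G n f"
  shows "braid_lift G f \<in> hom (braid_group n) G"
  using word_eval_closed[OF f]
  by (auto intro!: homI simp: carrier_braid_group braid_class_mult braid_lift_class[OF f]
      word_eval_append[OF f])

end

lemma braid_relations_perm: "braid_relations (sym_group n) n (\<lambda>i. transpose i (i + 1))"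
proof -
  have "transpose i (i + 1) \<circ> (transpose (i + 1) (i + 1 + 1) \<circ> transpose i (i + 1)) =
        transpose (i + 1) (i + 1 + 1) \<circ> (transpose i (i + 1) \<circ> transpose (i + 1) (i + 1 + 1))"
    for i :: nat
    by (auto simp: fun_eq_iff transpose_def)
  moreover have "transpose i (i + 1) \<circ> transpose j (j + 1) = transpose j (j + 1) \<circ> transpose i (i + 1)"
    if "i + 1 < j" for i j :: nat
    using that by (auto simp: fun_eq_iff transpose_def)
  ultimately show ?thesis
    unfolding braid_relations_def by (auto simp: sym_group_def intro!: permutes_swap_id)
qed

lemma braid_perm_class:
  "w \<in> braid_words n \<Longrightarrow>
    braid_perm n (braid_class n w) = word_eval (sym_group n) (\<lambda>i. transpose i (i + 1)) w"
  unfolding braid_perm_def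
  by (rule group.braid_lift_class[OF sym_group_is_group braid_relations_perm])

lemma braid_perm_hom: "braid_perm n \<in> hom (braid_group n) (sym_group n)"
  unfolding braid_perm_def
  by (rule group.braid_lift_hom[OF sym_group_is_group braid_relations_perm])


subsection \<open>The Burau representation is a homomorphism\<close>

lemma GL_simps:
  "carrier (GL n) = {A \<in> carrier_mat n n. \<exists>B\<in>carrier_mat n n. B * A = 1\<^sub>m n \<and> A * B = 1\<^sub>m n}"
  "mult (GL n) = (*)" "one (GL n) = 1\<^sub>m n"
  by (auto simp: GL_def units_of_def Units_def ring_mat_simps)

lemma GL_group: "group (GL n)"
  unfolding GL_def using ring_mat[of n "()"] by (intro monoid.units_group) (rule ring.is_monoid)

lemma burau_gen_carrier: "1 \<le> i \<Longrightarrow> i < n \<Longrightarrow> burau_gen n i \<in> carrier_mat n n"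
  by (intro carrier_matI) (auto simp: burau_gen_def dim_diag_block_mat mat_of_rows_list_def)

lemma burau_gen_index:
  assumes "1 \<le> i" "i < n" "r < n" "c < n"
  shows "burau_gen n i $$ (r, c) =
    (if r = i - 1 then (if c = i - 1 then 2 else if c = i then -1 else 0)
     else if r = i then (if c = i - 1 then 1 else 0)
     else if r = c then 1 else 0)"
proof -
  obtain k where k: "i = Suc k" using assms(1) by (cases i) auto
  obtain m where m: "n = Suc (Suc (k + m))" using assms(2) k by (auto simp: less_iff_Suc_add)
  have "r < k \<or> r = k \<or> r = Suc k \<or> (\<exists>r'. r = Suc (Suc (k + r')))"
    by presburger
  moreover have "c < k \<or> c = k \<or> c = Suc k \<or> (\<exists>c'. c = Suc (Suc (k + c')))"
    by presburger
  ultimately show ?thesis using assms(3,4)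
    unfolding k m burau_gen_def
    by (elim disjE exE) (simp_all add: four_block_mat_def mat_of_rows_list_def Let_def)
qed

definition burau_gen_inv :: "nat \<Rightarrow> nat \<Rightarrow> int mat" where
  "burau_gen_inv n i = mat n n (\<lambda>(r, c).
    if r = i - 1 then (if c = i then 1 else 0)
    else if r = i then (if c = i - 1 then -1 else if c = i then 2 else 0)
    else if r = c then 1 else 0)"

lemma sum_two_point:
  fixes f g :: "nat \<Rightarrow> int"
  assumes "a < n" "b < n" "a \<noteq> b" "\<And>k. k < n \<Longrightarrow> k \<noteq> a \<Longrightarrow> k \<noteq> b \<Longrightarrow> f k = 0"
  shows "(\<Sum>k = 0..<n. f k * g k) = f a * g a + f b * g b"
proof -
  have "(\<Sum>k = 0..<n. f k * g k) = (\<Sum>k\<in>{a, b}. f k * g k)"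
    using assms by (intro sum.mono_neutral_right) auto
  with assms(3) show ?thesis by simp
qed

lemma sum_one_point:
  fixes f g :: "nat \<Rightarrow> int"
  assumes "a < n" "\<And>k. k < n \<Longrightarrow> k \<noteq> a \<Longrightarrow> f k = 0"
  shows "(\<Sum>k = 0..<n. f k * g k) = f a * g a"
proof -
  have "(\<Sum>k = 0..<n. f k * g k) = (\<Sum>k\<in>{a}. f k * g k)"
    using assms by (intro sum.mono_neutral_right) auto
  then show ?thesis by simp
qed

lemma burau_gen_mult_index:
  assumes i: "1 \<le> i" "i < n" and A: "dim_row A = n" and rc: "r < n" "c < dim_col A"
  shows "(burau_gen n i * A) $$ (r, c) =
    (if r = i - 1 then 2 * A $$ (i - 1, c) - A $$ (i, c)
     else if r = i then A $$ (i - 1, c) else A $$ (r, c))"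
proof -
  have eq: "(burau_gen n i * A) $$ (r, c) = (\<Sum>k = 0..<n. burau_gen n i $$ (r, k) * A $$ (k, c))"
    using burau_gen_carrier[OF i] A rc by (simp add: scalar_prod_def)
  show ?thesis
  proof (cases "r = i - 1 \<or> r = i")
    case True
    have "(\<Sum>k = 0..<n. burau_gen n i $$ (r, k) * A $$ (k, c)) =
      burau_gen n i $$ (r, i - 1) * A $$ (i - 1, c) + burau_gen n i $$ (r, i) * A $$ (i, c)"
      using i rc True by (intro sum_two_point) (auto simp: burau_gen_index)
    with True i rc show ?thesis unfolding eq by (auto simp: burau_gen_index)
  next
    case False
    have "(\<Sum>k = 0..<n. burau_gen n i $$ (r, k) * A $$ (k, c)) =
      burau_gen n i $$ (r, r) * A $$ (r, c)"
      using i rc False by (intro sum_one_point) (auto simp: burau_gen_index)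
    with False i rc show ?thesis unfolding eq by (auto simp: burau_gen_index)
  qed
qed

lemma burau_gen_inv_carrier: "burau_gen_inv n i \<in> carrier_mat n n"
  by (simp add: burau_gen_inv_def)

lemma burau_gen_inv_index:
  assumes "r < n" "c < n"
  shows "burau_gen_inv n i $$ (r, c) =
    (if r = i - 1 then (if c = i then 1 else 0)
     else if r = i then (if c = i - 1 then -1 else if c = i then 2 else 0)
     else if r = c then 1 else 0)"
  using assms by (simp add: burau_gen_inv_def)

lemma burau_gen_inv_mult_index:
  assumes i: "1 \<le> i" "i < n" and A: "dim_row A = n" and rc: "r < n" "c < dim_col A"
  shows "(burau_gen_inv n i * A) $$ (r, c) =
    (if r = i - 1 then A $$ (i, c)
     else if r = i then 2 * A $$ (i, c) - A $$ (i - 1, c) else A $$ (r, c))"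
proof -
  have eq: "(burau_gen_inv n i * A) $$ (r, c) =
      (\<Sum>k = 0..<n. burau_gen_inv n i $$ (r, k) * A $$ (k, c))"
    using burau_gen_inv_carrier[of n i] A rc by (simp add: scalar_prod_def)
  show ?thesis
  proof (cases "r = i - 1 \<or> r = i")
    case True
    have "(\<Sum>k = 0..<n. burau_gen_inv n i $$ (r, k) * A $$ (k, c)) =
      burau_gen_inv n i $$ (r, i - 1) * A $$ (i - 1, c) + burau_gen_inv n i $$ (r, i) * A $$ (i, c)"
      using i rc True by (intro sum_two_point) (auto simp: burau_gen_inv_index)
    with True i rc show ?thesis unfolding eq by (auto simp: burau_gen_inv_index)
  next
    case False
    have "(\<Sum>k = 0..<n. burau_gen_inv n i $$ (r, k) * A $$ (k, c)) =
      burau_gen_inv n i $$ (r, r) * A $$ (r, c)"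
      using i rc False by (intro sum_one_point) (auto simp: burau_gen_inv_index)
    with False i rc show ?thesis unfolding eq by (auto simp: burau_gen_inv_index)
  qed
qed

lemma burau_gen_inverse:
  assumes i: "1 \<le> i" "i < n"
  shows "burau_gen n i * burau_gen_inv n i = 1\<^sub>m n" "burau_gen_inv n i * burau_gen n i = 1\<^sub>m n"
proof -
  have c: "dim_row (burau_gen n i) = n" "dim_col (burau_gen n i) = n"
    "dim_row (burau_gen_inv n i) = n" "dim_col (burau_gen_inv n i) = n"
    using burau_gen_carrier[OF i] burau_gen_inv_carrier[of n i] by auto
  show "burau_gen n i * burau_gen_inv n i = 1\<^sub>m n"
    using i by (intro eq_matI) (auto simp del: index_mult_mat(1) simp: c burau_gen_mult_index burau_gen_inv_index)
  show "burau_gen_inv n i * burau_gen n i = 1\<^sub>m n"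
    using i by (intro eq_matI) (auto simp del: index_mult_mat(1) simp: c burau_gen_inv_mult_index burau_gen_index)
qed

lemma burau_gen_GL: "1 \<le> i \<Longrightarrow> i < n \<Longrightarrow> burau_gen n i \<in> carrier (GL n)"
  unfolding GL_simps using burau_gen_carrier[of i n] burau_gen_inverse[of i n]
    burau_gen_inv_carrier[of n i] by blast

lemma inv_burau_gen:
  assumes i: "1 \<le> i" "i < n"
  shows "inv\<^bsub>GL n\<^esub> (burau_gen n i) = burau_gen_inv n i"
proof (rule group.inv_equality[OF GL_group])
  show "burau_gen_inv n i \<in> carrier (GL n)"
    unfolding GL_simps using burau_gen_carrier[OF i] burau_gen_inverse[OF i]
      burau_gen_inv_carrier[of n i] by blast
qed (use burau_gen_inverse[OF i] burau_gen_GL[OF i] in \<open>auto simp: GL_simps(2,3)\<close>)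

lemma braid_relations_burau: "braid_relations (GL n) n (burau_gen n)"
  unfolding braid_relations_def GL_simps(2)
proof (intro conjI allI impI; (elim conjE)?)
  fix i j assume i: "1 \<le> i" and ij: "i + 1 < j" and j: "j < n"
  then have c: "dim_row (burau_gen n i) = n" "dim_col (burau_gen n i) = n"
    "dim_row (burau_gen n j) = n" "dim_col (burau_gen n j) = n"
    using burau_gen_carrier[of i n] burau_gen_carrier[of j n] by auto
  obtain a b where ab: "i = Suc a" "j = Suc b" using i ij by (cases i; cases j) auto
  show "burau_gen n i * burau_gen n j = burau_gen n j * burau_gen n i"
  proof (rule eq_matI)
    fix r k assume "r < dim_row (burau_gen n j * burau_gen n i)"
      "k < dim_col (burau_gen n j * burau_gen n i)"
    then have rk: "r < n" "k < n" by (simp_all add: c)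
    consider "r = a" | "r = i" | "r = b" | "r = j" | "r \<noteq> a" "r \<noteq> i" "r \<noteq> b" "r \<noteq> j" by blast
    then show "(burau_gen n i * burau_gen n j) $$ (r, k) = (burau_gen n j * burau_gen n i) $$ (r, k)"
      using ij j rk unfolding ab
      by cases (simp_all del: index_mult_mat(1)
          add: c[unfolded ab] burau_gen_mult_index burau_gen_index)
  qed (simp_all add: c)
next
  fix i assume i: "1 \<le> i" and n: "i + 1 < n"
  then have c: "dim_row (burau_gen n i) = n" "dim_col (burau_gen n i) = n"
    "dim_row (burau_gen n (Suc i)) = n" "dim_col (burau_gen n (Suc i)) = n"
    using burau_gen_carrier[of i n] burau_gen_carrier[of "Suc i" n] by auto
  obtain a where a: "i = Suc a" using i by (cases i) auto
  show "burau_gen n i * (burau_gen n (i + 1) * burau_gen n i) =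
      burau_gen n (i + 1) * (burau_gen n i * burau_gen n (i + 1))"
  proof (rule eq_matI)
    fix r k assume "r < dim_row (burau_gen n (i + 1) * (burau_gen n i * burau_gen n (i + 1)))"
      "k < dim_col (burau_gen n (i + 1) * (burau_gen n i * burau_gen n (i + 1)))"
    then have rk: "r < n" "k < n" by (simp_all add: c)
    consider "r = a" | "r = i" | "r = Suc i" | "r \<noteq> a" "r \<noteq> i" "r \<noteq> Suc i" by blast
    then show "(burau_gen n i * (burau_gen n (i + 1) * burau_gen n i)) $$ (r, k) =
        (burau_gen n (i + 1) * (burau_gen n i * burau_gen n (i + 1))) $$ (r, k)"
      using n rk unfolding a
      by cases (simp_all del: index_mult_mat(1)
          add: c[unfolded a] burau_gen_mult_index burau_gen_index)
  qed (simp_all add: c)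
qed (use burau_gen_GL in auto)

lemma burau_class:
  "w \<in> braid_words n \<Longrightarrow> burau n (braid_class n w) = word_eval (GL n) (burau_gen n) w"
  unfolding burau_def by (rule group.braid_lift_class[OF GL_group braid_relations_burau])

lemma burau_hom: "burau n \<in> hom (braid_group n) (GL n)"
  unfolding burau_def by (rule group.braid_lift_hom[OF GL_group braid_relations_burau])


subsection \<open>The image of the Burau representation lies in \<open>\<Gamma>\<close>\<close>

lemma alt_form_add_smult:
  assumes "\<And>k. k < n \<Longrightarrow> x' $ k = x $ k + s * z $ k"
  shows "alt_form n x' y = alt_form n x y + s * alt_form n z y"
  unfolding alt_form_def sum_distrib_left sum.distrib[symmetric]
  using assms by (intro sum.cong) (auto simp: algebra_simps)

lemma alt_form_flip: "alt_form n x y = - alt_form n y x"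
proof -
  have "form_basis i j = - form_basis j i" for i j
    by (auto simp: form_basis_def add.commute)
  then have "x $ i * y $ j * form_basis i j = - (y $ j * x $ i * form_basis j i)" for i j
    by (metis mult.commute mult_minus_right)
  then have "alt_form n x y = - (\<Sum>i<n. \<Sum>j<n. y $ j * x $ i * form_basis j i)"
    by (simp add: alt_form_def sum_negf)
  also have "(\<Sum>i<n. \<Sum>j<n. y $ j * x $ i * form_basis j i) = alt_form n y x"
    unfolding alt_form_def by (rule sum.swap)
  finally show ?thesis .
qed

lemma burau_gen_mult_vec_index:
  assumes i: "1 \<le> i" "i < n" and x: "x \<in> carrier_vec n" and r: "r < n"
  shows "(burau_gen n i *\<^sub>v x) $ r =
    (if r = i - 1 then 2 * x $ (i - 1) - x $ i else if r = i then x $ (i - 1) else x $ r)"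
proof -
  have eq: "(burau_gen n i *\<^sub>v x) $ r = (\<Sum>k = 0..<n. burau_gen n i $$ (r, k) * x $ k)"
    using burau_gen_carrier[OF i] x r by (simp add: scalar_prod_def)
  show ?thesis
  proof (cases "r = i - 1 \<or> r = i")
    case True
    have "(\<Sum>k = 0..<n. burau_gen n i $$ (r, k) * x $ k) =
      burau_gen n i $$ (r, i - 1) * x $ (i - 1) + burau_gen n i $$ (r, i) * x $ i"
      using i r True by (intro sum_two_point) (auto simp: burau_gen_index)
    with True i r show ?thesis unfolding eq by (auto simp: burau_gen_index)
  next
    case False
    have "(\<Sum>k = 0..<n. burau_gen n i $$ (r, k) * x $ k) = burau_gen n i $$ (r, r) * x $ r"
      using i r False by (intro sum_one_point) (auto simp: burau_gen_index)
    with False i r show ?thesis unfolding eq by (auto simp: burau_gen_index)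
  qed
qed

lemma alt_form_burau_vector:
  assumes i: "1 \<le> i" "i < n"
  shows "alt_form n (vec n (\<lambda>k. if k = i - 1 \<or> k = i then 1 else 0)) y = y $ i - y $ (i - 1)"
    (is "alt_form n ?c y = _")
proof -
  obtain m where m: "i = Suc m" using i by (cases i) auto
  have "alt_form n ?c y = (\<Sum>k = 0..<n. ?c $ k * (\<Sum>j<n. y $ j * form_basis k j))"
    by (simp add: alt_form_def sum_distrib_left mult.assoc atLeast0LessThan)
  also have "\<dots> = ?c $ m * (\<Sum>j<n. y $ j * form_basis m j) + ?c $ i * (\<Sum>j<n. y $ j * form_basis i j)"
    using i m by (intro sum_two_point) auto
  also have "\<dots> = (\<Sum>j = 0..<n. (form_basis m j + form_basis i j) * y $ j)"
    using i m by (simp add: sum.distrib[symmetric] algebra_simps atLeast0LessThan)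
  also have "\<dots> = (form_basis m m + form_basis i m) * y $ m + (form_basis m i + form_basis i i) * y $ i"
    using i m by (intro sum_two_point) (auto simp: form_basis_def)
  also have "\<dots> = y $ i - y $ (i - 1)"
    by (simp add: form_basis_def m)
  finally show ?thesis .
qed

lemma burau_gen_alt_form:
  assumes i: "1 \<le> i" "i < n" and x: "x \<in> carrier_vec n" and y: "y \<in> carrier_vec n"
  shows "alt_form n (burau_gen n i *\<^sub>v x) (burau_gen n i *\<^sub>v y) = alt_form n x y"
proof -
  define c :: "int vec" where "c = vec n (\<lambda>k. if k = i - 1 \<or> k = i then 1 else 0)"
  have c: "alt_form n c z = z $ i - z $ (i - 1)" for z
    unfolding c_def by (rule alt_form_burau_vector[OF i])
  have cc: "alt_form n c c = 0"
    using i by (simp add: c) (simp add: c_def)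
  have T: "(burau_gen n i *\<^sub>v z) $ k = z $ k + (z $ (i - 1) - z $ i) * c $ k"
    if "z \<in> carrier_vec n" "k < n" for z k
    using that i by (auto simp: burau_gen_mult_vec_index[OF i] c_def)
  let ?s = "x $ (i - 1) - x $ i" and ?t = "y $ (i - 1) - y $ i"
  have left: "alt_form n (burau_gen n i *\<^sub>v x) z = alt_form n x z + ?s * alt_form n c z" for z
    by (rule alt_form_add_smult) (rule T[OF x])
  have right: "alt_form n z (burau_gen n i *\<^sub>v y) = alt_form n z y + ?t * alt_form n z c" for z
    using alt_form_add_smult[OF T[OF y], where y = z] alt_form_flip[of n z] by (simp add: algebra_simps)
  have xc: "alt_form n x c = ?s" using alt_form_flip[of n x c] c[of x] by simp
  show ?thesis unfolding left right cc unfolding c xc by (simp add: algebra_simps)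
qed

lemma burau_gen_Gamma:
  assumes i: "1 \<le> i" "i < n"
  shows "burau_gen n i \<in> Gamma n"
proof -
  have v: "burau_gen n i *\<^sub>v v_vec n = v_vec n"
  proof (rule eq_vecI)
    fix r assume "r < dim_vec (v_vec n)"
    then have "r < n" by (simp add: v_vec_def)
    then show "(burau_gen n i *\<^sub>v v_vec n) $ r = v_vec n $ r"
      using i by (subst burau_gen_mult_vec_index[OF i]) (auto simp: v_vec_def)
  qed (use burau_gen_carrier[OF i] in \<open>auto simp: v_vec_def\<close>)
  obtain m where m: "i = Suc m" using i by (cases i) auto
  have w: "mat_of_row (w_vec n) * burau_gen n i = mat_of_row (w_vec n)"
  proof (rule eq_matI)
    fix r c assume "r < dim_row (mat_of_row (w_vec n))" "c < dim_col (mat_of_row (w_vec n))"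
    then have r: "r = 0" and c: "c < n" by (auto simp: mat_of_row_def w_vec_def)
    have "(mat_of_row (w_vec n) * burau_gen n i) $$ (r, c) =
        (\<Sum>k = 0..<n. burau_gen n i $$ (k, c) * (-1) ^ k)"
      using burau_gen_carrier[OF i] r c
      by (simp add: scalar_prod_def mat_of_row_def w_vec_def mult.commute)
    also have "\<dots> = (-1) ^ c"
    proof (cases "c = m \<or> c = i")
      case True
      have "(\<Sum>k = 0..<n. burau_gen n i $$ (k, c) * (-1) ^ k) =
          burau_gen n i $$ (m, c) * (-1) ^ m + burau_gen n i $$ (i, c) * (-1) ^ i"
        using i c True m by (intro sum_two_point) (auto simp: burau_gen_index)
      with True i c m show ?thesis by (auto simp: burau_gen_index)
    next
      case False
      have "(\<Sum>k = 0..<n. burau_gen n i $$ (k, c) * (-1) ^ k) = burau_gen n i $$ (c, c) * (-1) ^ c"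
        using i c False m by (intro sum_one_point) (auto simp: burau_gen_index)
      with False i c m show ?thesis by (auto simp: burau_gen_index)
    qed
    finally show "(mat_of_row (w_vec n) * burau_gen n i) $$ (r, c) = mat_of_row (w_vec n) $$ (r, c)"
      using r c by (simp add: mat_of_row_def w_vec_def)
  qed (use burau_gen_carrier[OF i] in \<open>auto simp: mat_of_row_def w_vec_def\<close>)
  show ?thesis
    unfolding Gamma_def using burau_gen_GL[OF i] burau_gen_alt_form[OF i] v w by auto
qed

lemma inv_GL:
  assumes "A \<in> carrier (GL n)"
  shows "inv\<^bsub>GL n\<^esub> A \<in> carrier_mat n n" "inv\<^bsub>GL n\<^esub> A * A = 1\<^sub>m n" "A * inv\<^bsub>GL n\<^esub> A = 1\<^sub>m n"
  using group.inv_closed[OF GL_group assms] group.l_inv[OF GL_group assms]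
    group.r_inv[OF GL_group assms] by (auto simp: GL_simps)

lemma subgroup_Gamma: "subgroup (Gamma n) (GL n)"
proof (rule group.subgroupI[OF GL_group])
  have wc: "mat_of_row (w_vec n) \<in> carrier_mat 1 n" by (simp add: mat_of_row_def w_vec_def)
  have vc: "v_vec n \<in> carrier_vec n" by (simp add: v_vec_def)
  show "Gamma n \<subseteq> carrier (GL n)" by (auto simp: Gamma_def)
  have "1\<^sub>m n \<in> Gamma n"
    using group.is_monoid[OF GL_group, of n] monoid.one_closed[of "GL n"] wc vc
    by (auto simp: Gamma_def GL_simps(2,3))
  then show "Gamma n \<noteq> {}" by blast
  fix A assume A: "A \<in> Gamma n"
  then have AG: "A \<in> carrier (GL n)" and Ac: "A \<in> carrier_mat n n"
    by (auto simp: Gamma_def GL_simps)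
  let ?B = "inv\<^bsub>GL n\<^esub> A"
  note B = inv_GL[OF AG]
  have AB: "A *\<^sub>v (?B *\<^sub>v x) = x" if "x \<in> carrier_vec n" for x
    using assoc_mult_mat_vec[OF Ac B(1) that] B(3) that by simp
  have "alt_form n (?B *\<^sub>v x) (?B *\<^sub>v y) = alt_form n x y"
    if "x \<in> carrier_vec n" "y \<in> carrier_vec n" for x y
  proof -
    have "?B *\<^sub>v x \<in> carrier_vec n" "?B *\<^sub>v y \<in> carrier_vec n" using B(1) that by auto
    then have "alt_form n (A *\<^sub>v (?B *\<^sub>v x)) (A *\<^sub>v (?B *\<^sub>v y)) = alt_form n (?B *\<^sub>v x) (?B *\<^sub>v y)"
      using A by (auto simp: Gamma_def)
    with AB that show ?thesis by simp
  qed
  moreover have "?B *\<^sub>v v_vec n = v_vec n"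
  proof -
    have "?B *\<^sub>v (A *\<^sub>v v_vec n) = v_vec n"
      using assoc_mult_mat_vec[OF B(1) Ac vc] B(2) vc by simp
    with A show ?thesis by (auto simp: Gamma_def)
  qed
  moreover have "mat_of_row (w_vec n) * ?B = mat_of_row (w_vec n)"
  proof -
    have "mat_of_row (w_vec n) * A * ?B = mat_of_row (w_vec n)"
      using assoc_mult_mat[OF wc Ac B(1)] B(3) right_mult_one_mat[OF wc] by simp
    with A show ?thesis by (auto simp: Gamma_def)
  qed
  ultimately show "?B \<in> Gamma n"
    using group.inv_closed[OF GL_group AG] by (simp add: Gamma_def)
  fix C assume C: "C \<in> Gamma n"
  then have CG: "C \<in> carrier (GL n)" and Cc: "C \<in> carrier_mat n n"
    by (auto simp: Gamma_def GL_simps)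
  have "A * C \<in> carrier (GL n)"
    using monoid.m_closed[OF group.is_monoid[OF GL_group] AG CG] by (simp add: GL_simps(2))
  moreover have "alt_form n (A * C *\<^sub>v x) (A * C *\<^sub>v y) = alt_form n x y"
    if "x \<in> carrier_vec n" "y \<in> carrier_vec n" for x y
  proof -
    have "C *\<^sub>v x \<in> carrier_vec n" "C *\<^sub>v y \<in> carrier_vec n" using Cc that by auto
    then have "alt_form n (A *\<^sub>v (C *\<^sub>v x)) (A *\<^sub>v (C *\<^sub>v y)) = alt_form n (C *\<^sub>v x) (C *\<^sub>v y)"
      using A by (auto simp: Gamma_def)
    also have "\<dots> = alt_form n x y" using C that by (auto simp: Gamma_def)
    finally show ?thesis using assoc_mult_mat_vec[OF Ac Cc] that by simp
  qed
  moreover have "A * C *\<^sub>v v_vec n = v_vec n"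
    using assoc_mult_mat_vec[OF Ac Cc vc] A C by (simp add: Gamma_def)
  moreover have "mat_of_row (w_vec n) * (A * C) = mat_of_row (w_vec n)"
    using assoc_mult_mat[OF wc Ac Cc] A C by (simp add: Gamma_def)
  ultimately show "A \<otimes>\<^bsub>GL n\<^esub> C \<in> Gamma n"
    by (simp add: Gamma_def GL_simps(2))
qed

lemma word_eval_burau_Gamma:
  "w \<in> braid_words n \<Longrightarrow> word_eval (GL n) (burau_gen n) w \<in> Gamma n"
proof (induction w)
  case Nil
  then show ?case using subgroup.one_closed[OF subgroup_Gamma] by simp
next
  case (Cons x w)
  obtain i b where x: "x = (i, b)" by (cases x)
  with Cons have i: "1 \<le> i" "i < n" by auto
  have "burau_gen n i \<in> Gamma n" "inv\<^bsub>GL n\<^esub> (burau_gen n i) \<in> Gamma n"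
    using burau_gen_Gamma[OF i] subgroup.m_inv_closed[OF subgroup_Gamma] by auto
  with Cons x show ?case by (auto intro: subgroup.m_closed[OF subgroup_Gamma])
qed

lemma burau_Gamma: "b \<in> carrier (braid_group n) \<Longrightarrow> burau n b \<in> Gamma n"
  by (auto simp: carrier_braid_group burau_class word_eval_burau_Gamma)


subsection \<open>Congruence subgroups\<close>

lemma mat_cong_mult:
  assumes "mat_cong l A A'" and "mat_cong l B B'"
    and "A \<in> carrier_mat n n" and "B \<in> carrier_mat n n"
  shows "mat_cong l (A * B) (A' * B')"
proof -
  have A': "A' \<in> carrier_mat n n" and B': "B' \<in> carrier_mat n n"
    using assms by (auto simp: mat_cong_def)
  have "int l dvd (A * B) $$ (i, j) - (A' * B') $$ (i, j)" if ij: "i < n" "j < n" for i j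
  proof -
    have "(A * B) $$ (i, j) - (A' * B') $$ (i, j) =
        (\<Sum>k = 0..<n. (A $$ (i, k) - A' $$ (i, k)) * B $$ (k, j) +
                      A' $$ (i, k) * (B $$ (k, j) - B' $$ (k, j)))"
      using assms(3,4) A' B' ij
      by (simp add: scalar_prod_def sum_subtractf[symmetric] algebra_simps)
    also have "int l dvd \<dots>"
      using assms ij by (intro dvd_sum dvd_add dvd_mult dvd_mult2) (auto simp: mat_cong_def)
    finally show ?thesis .
  qed
  then show ?thesis using assms A' B' by (auto simp: mat_cong_def)
qed

lemma mat_cong_refl [simp]: "mat_cong l A A"
  by (simp add: mat_cong_def)

lemma subgroup_Gamma_cong: "subgroup (Gamma_cong n l) (GL n)"
proof (rule group.subgroupI[OF GL_group])
  show "Gamma_cong n l \<subseteq> carrier (GL n)" by (auto simp: Gamma_cong_def Gamma_def)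
  have "1\<^sub>m n \<in> Gamma_cong n l"
    using subgroup.one_closed[OF subgroup_Gamma, of n] by (simp add: Gamma_cong_def GL_simps(3))
  then show "Gamma_cong n l \<noteq> {}" by blast
  fix A assume A: "A \<in> Gamma_cong n l"
  then have AG: "A \<in> carrier (GL n)" and Ac: "A \<in> carrier_mat n n"
    by (auto simp: Gamma_cong_def Gamma_def GL_simps)
  note B = inv_GL[OF AG]
  have "mat_cong l (inv\<^bsub>GL n\<^esub> A * A) (inv\<^bsub>GL n\<^esub> A * 1\<^sub>m n)"
    using A Ac B by (intro mat_cong_mult) (auto simp: Gamma_cong_def)
  then have "mat_cong l (inv\<^bsub>GL n\<^esub> A) (1\<^sub>m n)"
    using B by (auto simp: mat_cong_def dvd_diff_commute)
  then show "inv\<^bsub>GL n\<^esub> A \<in> Gamma_cong n l"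
    using A subgroup.m_inv_closed[OF subgroup_Gamma] by (auto simp: Gamma_cong_def)
  fix C assume C: "C \<in> Gamma_cong n l"
  then have "C \<in> carrier_mat n n" by (auto simp: Gamma_cong_def Gamma_def GL_simps)
  then have "mat_cong l (A * C) (1\<^sub>m n * 1\<^sub>m n)"
    using A C Ac by (intro mat_cong_mult) (auto simp: Gamma_cong_def)
  then show "A \<otimes>\<^bsub>GL n\<^esub> C \<in> Gamma_cong n l"
    using A C subgroup.m_closed[OF subgroup_Gamma, of A n C]
    by (simp add: Gamma_cong_def GL_simps(2))
qed


subsection \<open>The embedding of the symmetric group is well defined\<close>

lemma word_eval_mod2:
  assumes "w \<in> braid_words n" and "r < n" and "c < n"
  shows "word_eval (GL n) (burau_gen n) w $$ (r, c) mod 2 =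
    (if word_eval (sym_group n) (\<lambda>i. transpose i (i + 1)) w (c + 1) = r + 1 then 1 else 0)"
  using assms
proof (induction w arbitrary: r)
  case Nil
  then show ?case by (auto simp: GL_simps(3) sym_group_one)
next
  case (Cons x w)
  obtain i b where x: "x = (i, b)" by (cases x)
  with Cons have i: "1 \<le> i" "i < n" and w: "w \<in> braid_words n" by auto
  define E where "E = word_eval (GL n) (burau_gen n) w"
  define q where "q = word_eval (sym_group n) (\<lambda>i. transpose i (i + 1)) w (c + 1)"
  have E: "dim_row E = n" "dim_col E = n"
    using word_eval_burau_Gamma[OF w] by (auto simp: E_def Gamma_def GL_simps)
  have IH: "E $$ (r, c) mod 2 = (if q = r + 1 then 1 else 0)" if "r < n" for r
    using Cons.IH[OF w that Cons.prems(3)] by (simp add: E_def q_def)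
  have "inv\<^bsub>sym_group n\<^esub> (transpose i (i + 1)) = transpose i (i + 1)"
    using i by (intro group.inv_equality[OF sym_group_is_group])
      (auto simp: sym_group_def intro!: permutes_swap_id)
  then have perm: "word_eval (sym_group n) (\<lambda>i. transpose i (i + 1)) (x # w) (c + 1) =
      transpose i (i + 1) q"
    using x by (simp add: q_def sym_group_mult)
  have mod2: "(2 * a - d) mod 2 = d mod 2" for a d :: int by presburger
  have eval: "word_eval (GL n) (burau_gen n) (x # w) = (if b then burau_gen n i else burau_gen_inv n i) * E"
    using x i by (simp add: E_def GL_simps(2) inv_burau_gen)
  have "word_eval (GL n) (burau_gen n) (x # w) $$ (r, c) mod 2 =
      (if r = i - 1 then E $$ (i, c) else if r = i then E $$ (i - 1, c) else E $$ (r, c)) mod 2"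
    unfolding eval using i Cons.prems(2,3) E
    by (simp add: burau_gen_mult_index burau_gen_inv_mult_index mod2 del: index_mult_mat(1))
  also have "\<dots> = (if transpose i (i + 1) q = r + 1 then 1 else 0)"
    using i Cons.prems(2,3) IH[of i] IH[of "i - 1"] IH[of r] by (auto simp: transpose_def)
  finally show ?case unfolding perm .
qed

lemma burau_cong_2:
  assumes b: "b \<in> carrier (braid_group n)" "b' \<in> carrier (braid_group n)"
    and eq: "braid_perm n b = braid_perm n b'"
  shows "mat_cong 2 (burau n b) (burau n b')"
proof -
  obtain w w' where w: "w \<in> braid_words n" "b = braid_class n w"
    and w': "w' \<in> braid_words n" "b' = braid_class n w'"
    using b by (auto simp: carrier_braid_group)
  have "burau n b $$ (r, c) mod 2 = burau n b' $$ (r, c) mod 2" if "r < n" "c < n" for r c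
    using word_eval_mod2[OF w(1) that] word_eval_mod2[OF w'(1) that] eq w w'
    by (simp add: burau_class braid_perm_class)
  moreover have "burau n b \<in> carrier_mat n n" "burau n b' \<in> carrier_mat n n"
    using burau_Gamma b by (auto simp: Gamma_def GL_simps)
  ultimately show ?thesis by (auto simp: mat_cong_def mod_eq_dvd_iff)
qed

lemma sym_mod2_braid_perm:
  assumes b: "b \<in> carrier (braid_group n)"
  shows "sym_mod2 n (braid_perm n b) = Gamma_cong n 2 #>\<^bsub>GL n\<^esub> burau n b"
proof -
  have const: "Gamma_cong n 2 #>\<^bsub>GL n\<^esub> burau n b' = Gamma_cong n 2 #>\<^bsub>GL n\<^esub> burau n b"
    if b': "b' \<in> carrier (braid_group n)" "braid_perm n b' = braid_perm n b" for b'
  proof -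
    let ?A = "burau n b" and ?C = "burau n b'"
    have AG: "?A \<in> Gamma n" "?C \<in> Gamma n" using b b' burau_Gamma by auto
    then have A: "?A \<in> carrier (GL n)" "?A \<in> carrier_mat n n" "?C \<in> carrier_mat n n"
      by (auto simp: Gamma_def GL_simps)
    note B = inv_GL[OF A(1)]
    have "mat_cong 2 (?C * inv\<^bsub>GL n\<^esub> ?A) (?A * inv\<^bsub>GL n\<^esub> ?A)"
      using burau_cong_2[OF b'(1) b b'(2)] A B by (intro mat_cong_mult) auto
    moreover have "?C * inv\<^bsub>GL n\<^esub> ?A \<in> Gamma n"
      using subgroup.m_closed[OF subgroup_Gamma AG(2) subgroup.m_inv_closed[OF subgroup_Gamma AG(1)]]
      by (simp add: GL_simps(2))
    ultimately have "?C * inv\<^bsub>GL n\<^esub> ?A \<in> Gamma_cong n 2" using B by (simp add: Gamma_cong_def)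
    moreover have "?C = ?C * inv\<^bsub>GL n\<^esub> ?A * ?A"
      using assoc_mult_mat[OF A(3) B(1) A(2)] B(2) A(3) by simp
    ultimately have "?C \<in> Gamma_cong n 2 #>\<^bsub>GL n\<^esub> ?A"
      unfolding r_coset_def by (auto simp: GL_simps(2))
    then show ?thesis
      by (rule group.repr_independence[OF GL_group _ A(1) subgroup_Gamma_cong, symmetric])
  qed
  have "(\<lambda>b'. Gamma_cong n 2 #>\<^bsub>GL n\<^esub> burau n b') `
      {b' \<in> carrier (braid_group n). braid_perm n b' = braid_perm n b} =
      {Gamma_cong n 2 #>\<^bsub>GL n\<^esub> burau n b}" (is "?f ` ?S = _")
  proof (intro equalityI subsetI)
    fix X assume "X \<in> ?f ` ?S"
    then obtain b' where "b' \<in> ?S" "X = ?f b'" by blast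
    with const[of b'] show "X \<in> {?f b}" by blast
  next
    fix X assume "X \<in> {?f b}"
    with b show "X \<in> ?f ` ?S" by blast
  qed
  then show ?thesis by (simp add: sym_mod2_def)
qed

end

theory Submission
  imports Defs
begin

text \<open>The key point is that every \<open>A \<in> \<Gamma>\<^sub>n\<^sub>-\<^sub>1\<close> with exactly one odd entry in each column lies in the
  image of the Burau representation; in particular the image contains \<open>\<Gamma>\<^sub>n\<^sub>-\<^sub>1[2]\<close>.  This goes by
  induction on \<open>n\<close>, since the stabilizer of \<open>e\<^sub>n\<close> in \<open>\<Gamma>\<^sub>n\<^sub>-\<^sub>1\<close> is \<open>\<Gamma>\<^sub>n\<^sub>-\<^sub>2\<close>: it suffices to move the last
  column \<open>x\<close> of \<open>A\<close> to \<open>e\<^sub>n\<close> by a braid.  After the sign change \<open>x\<^sub>i \<mapsto> (-1)\<^sup>i x\<^sub>i\<close> the generators act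
  on adjacent coordinates with sum \<open>s\<close> by \<open>(a, b) \<mapsto> (a + s, b - s)\<close>.  Decreasing \<open>\<Sum>\<bar>x\<^sub>i\<bar>\<close> as long as
  possible, one arrives at a list of entries of one sign, followed by blocks \<open>(a, -a)\<close> and by zeros.
  For even \<open>n\<close> the coordinates sum to \<open>\<plusminus>1\<close>, there is a zero left over, and with its help the full twist
  on four strands kills the blocks.  For odd \<open>n\<close> one treats \<open>x - v\<^sub>n\<close> instead, whose coordinates sum to
  \<open>0\<close>; it is primitive with a single even entry, and the full twist on four strands performs a
  Euclidean algorithm on the block entries.\<close>


section \<open>The braid group action on integer lists\<close>

text \<open>A step is the action of one generator on neighbouring coordinates after the sign change.
  Lists are used so that a move on a few strands embeds into any context.\<close>

inductive burau_equiv :: "int list \<Rightarrow> int list \<Rightarrow> bool" (infix "\<approx>" 50) where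
  step: "us @ [a, b] @ vs \<approx> us @ [2 * a + b, - a] @ vs"
| refl [simp]: "xs \<approx> xs"
| sym: "xs \<approx> ys \<Longrightarrow> ys \<approx> xs"
| trans [trans]: "xs \<approx> ys \<Longrightarrow> ys \<approx> zs \<Longrightarrow> xs \<approx> zs"

lemma burau_equiv_context: "xs \<approx> ys \<Longrightarrow> us @ xs @ vs \<approx> us @ ys @ vs"
proof (induction rule: burau_equiv.induct)
  case (step us' a b vs')
  show ?case using burau_equiv.step[of "us @ us'" a b "vs' @ vs"] by simp
qed (auto intro: burau_equiv.intros)

lemma burau_equiv_append: "xs \<approx> xs' \<Longrightarrow> ys \<approx> ys' \<Longrightarrow> xs @ ys \<approx> xs' @ ys'"
  using burau_equiv_context[of xs xs' "[]" ys] burau_equiv_context[of ys ys' xs' "[]"]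
  by (auto intro: burau_equiv.trans)

lemma burau_equiv_Cons: "xs \<approx> ys \<Longrightarrow> x # xs \<approx> x # ys"
  using burau_equiv_context[of xs ys "[x]" "[]"] by simp

lemma burau_equiv_length: "xs \<approx> ys \<Longrightarrow> length xs = length ys"
  by (induction rule: burau_equiv.induct) auto

lemma burau_equiv_sum_list: "xs \<approx> ys \<Longrightarrow> sum_list xs = sum_list ys"
  by (induction rule: burau_equiv.induct) auto

text \<open>Modulo 2 a step only swaps the two entries.\<close>

lemma burau_equiv_odd: "xs \<approx> ys \<Longrightarrow> length (filter odd xs) = length (filter odd ys)"
  by (induction rule: burau_equiv.induct) auto

text \<open>A step is invertible over the integers, so it preserves the ideal generated by the
  entries.\<close>

lemma burau_equiv_dvd: "xs \<approx> ys \<Longrightarrow> (\<forall>x\<in>set xs. d dvd x) \<longleftrightarrow> (\<forall>y\<in>set ys. d dvd y)"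
proof (induction rule: burau_equiv.induct)
  case (step us a b vs)
  have "d dvd a \<Longrightarrow> d dvd 2 * a + b \<longleftrightarrow> d dvd b" by (simp add: dvd_add_right_iff)
  then show ?case by auto
qed auto

section \<open>Moves on two, three and four neighbouring entries\<close>

lemma burau_equiv_pair_nat: "[a, b] \<approx> [a + int k * (a + b), b - int k * (a + b)]"
proof (induction k)
  case (Suc k)
  note Suc
  also have "[a + int k * (a + b), b - int k * (a + b)] \<approx>
      [2 * (a + int k * (a + b)) + (b - int k * (a + b)), - (a + int k * (a + b))]"
    using burau_equiv.step[of "[]" "a + int k * (a + b)" "b - int k * (a + b)" "[]"] by simp
  finally show ?case by (simp add: algebra_simps)
qed simp

lemma burau_equiv_pair: "[a, b] \<approx> [a + k * (a + b), b - k * (a + b)]"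
proof (cases "k \<ge> 0")
  case True
  then show ?thesis using burau_equiv_pair_nat[of a b "nat k"] by simp
next
  case False
  \<comment> \<open>For negative \<open>k\<close>, applying \<open>- k\<close> steps to the target
    leads back to the source, since the sum of the pair is unchanged.\<close>
  then show ?thesis
    using burau_equiv_pair_nat[of "a + k * (a + b)" "b - k * (a + b)" "nat (- k)"]
    by (simp add: burau_equiv.sym)
qed

lemma burau_equiv_swap_zero: "[0, s] \<approx> [s, 0]"
  using burau_equiv_pair[of 0 s 1] by simp

lemma burau_equiv_move_zero: "0 # xs \<approx> xs @ [0]"
proof (induction xs)
  case (Cons x xs)
  have "0 # x # xs \<approx> x # 0 # xs"
    using burau_equiv_context[OF burau_equiv_swap_zero[of x], of "[]" xs] by simp
  also have "x # 0 # xs \<approx> x # xs @ [0]" by (rule burau_equiv_Cons[OF Cons.IH])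
  finally show ?case by simp
qed simp

lemma burau_equiv_move_zeros: "replicate m 0 @ xs \<approx> xs @ replicate m 0"
proof (induction m)
  case (Suc m)
  have "0 # replicate m 0 @ xs \<approx> 0 # xs @ replicate m 0" by (rule burau_equiv_Cons[OF Suc.IH])
  also have "0 # xs @ replicate m 0 \<approx> (xs @ replicate m 0) @ [0]" by (rule burau_equiv_move_zero)
  finally show ?case by (simp add: replicate_append_same)
qed simp

text \<open>Two pair moves carry \<open>z\<close> across the block, which comes out with its sign
  reversed.\<close>

lemma burau_equiv_move_block1: "[a, - a, z] \<approx> [z, - a, a]"
proof -
  have "[a, - a, z] \<approx> [a, z - 2 * a, a]"
    using burau_equiv_context[OF burau_equiv_pair[of "- a" z 1], of "[a]" "[]"] by simp
  also have "\<dots> \<approx> [z, - a, a]"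
    using burau_equiv_context[OF burau_equiv_pair[of a "z - 2 * a" 1], of "[]" "[a]"] by simp
  finally show ?thesis .
qed

text \<open>The sign is reversed once for each entry passed, so only the absolute value is
  recorded.\<close>

lemma burau_equiv_move_block: "\<exists>b. \<bar>b\<bar> = \<bar>a\<bar> \<and> [a, - a] @ xs \<approx> xs @ [b, - b]"
proof (induction xs arbitrary: a)
  case (Cons x xs)
  obtain b where b: "\<bar>b\<bar> = \<bar>- a\<bar>" "[- a, - (- a)] @ xs \<approx> xs @ [b, - b]" using Cons.IH by blast
  have "[a, - a] @ x # xs \<approx> x # [- a, - (- a)] @ xs"
    using burau_equiv_context[OF burau_equiv_move_block1[of a x], of "[]" xs] by simp
  also have "\<dots> \<approx> x # xs @ [b, - b]" by (rule burau_equiv_Cons[OF b(2)])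
  finally show ?case using b(1) by auto
qed auto

text \<open>The first block passes two entries, so its sign is reversed twice.\<close>

lemma burau_equiv_swap_blocks: "[a, - a, b, - b] \<approx> [b, - b, a, - a]"
proof -
  have "[a, - a, b, - b] \<approx> [b, - a, a, - b]"
    using burau_equiv_context[OF burau_equiv_move_block1[of a b], of "[]" "[- b]"] by simp
  also have "\<dots> \<approx> [b, - b, a, - a]"
    using burau_equiv_context[OF burau_equiv_move_block1[of "- a" "- b"], of "[b]" "[]"] by simp
  finally show ?thesis .
qed

text \<open>Passing the zero reverses the sign of the block; moving the zero back to the right
  changes nothing else.\<close>

lemma burau_equiv_flip_block: "[a, - a, 0] \<approx> [- a, a, 0]"
proof -
  have "[a, - a, 0] \<approx> 0 # [- a, a]" using burau_equiv_move_block1[of a 0] by simp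
  also have "\<dots> \<approx> [- a, a] @ [0]" by (rule burau_equiv_move_zero)
  finally show ?thesis by simp
qed

text \<open>The full twist on four strands acts as the square of the transvection along
  \<open>(1, -1, 1, -1)\<close>.\<close>

lemma burau_equiv_quad1:
  "[p, q, r, t] \<approx> [p + 2 * (p + q + r + t), q - 2 * (p + q + r + t),
     r + 2 * (p + q + r + t), t - 2 * (p + q + r + t)]"
proof -
  \<comment> \<open>\<open>D\<close> is the action of the three generators in succession; its fourth
    power is the full twist.\<close>
  have D: "[p, q, r, t] \<approx> [2 * p + q, r - 2 * p, 2 * p + t, - p]" for p q r t
  proof -
    have "[p, q, r, t] \<approx> [2 * p + q, - p, r, t]"
      using burau_equiv.step[of "[]" p q "[r, t]"] by simp
    also have "\<dots> \<approx> [2 * p + q, r - 2 * p, p, t]"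
      using burau_equiv.step[of "[2 * p + q]" "- p" r "[t]"] by simp
    also have "\<dots> \<approx> [2 * p + q, r - 2 * p, 2 * p + t, - p]"
      using burau_equiv.step[of "[2 * p + q, r - 2 * p]" p t "[]"] by simp
    finally show ?thesis .
  qed
  note D[of p q r t]
  also note D
  also note D
  also note D
  finally show ?thesis by (simp add: algebra_simps)
qed

lemma burau_equiv_quad_nat:
  assumes "s = p + q + r + t"
  shows "[p, q, r, t] \<approx> [p + 2 * (int k * s), q - 2 * (int k * s), r + 2 * (int k * s), t - 2 * (int k * s)]"
proof (induction k)
  case (Suc k)
  note Suc
  also note burau_equiv_quad1
  finally show ?case using assms by (simp add: algebra_simps)
qed simp

lemma burau_equiv_quad:
  assumes "s = p + q + r + t"
  shows "[p, q, r, t] \<approx> [p + 2 * (k * s), q - 2 * (k * s), r + 2 * (k * s), t - 2 * (k * s)]"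
proof (cases "k \<ge> 0")
  case True
  then show ?thesis using burau_equiv_quad_nat[OF assms, of "nat k"] by simp
next
  case False
  then show ?thesis
    using burau_equiv_quad_nat[of s "p + 2 * (k * s)" "q - 2 * (k * s)" "r + 2 * (k * s)"
        "t - 2 * (k * s)" "nat (- k)"] assms
    by (simp add: burau_equiv.sym)
qed

section \<open>Normal form of a list under the moves\<close>

text \<open>Pairs of sum 0 are exactly those fixed by a step, so pair moves cannot shrink
  them.\<close>

definition blocks :: "int list \<Rightarrow> int list" where
  "blocks as = concat (map (\<lambda>a. [a, - a]) as)"

lemma blocks_simps [simp]:
  "blocks [] = []" "blocks (a # as) = a # - a # blocks as" "blocks (as @ bs) = blocks as @ blocks bs"
  by (simp_all add: blocks_def)

lemma blocks_props [simp]: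
  "sum_list (blocks as) = 0" "length (blocks as) = 2 * length as"
  "length (filter odd (blocks as)) = 2 * length (filter odd as)"
  "(\<Sum>x\<leftarrow>blocks as. \<bar>x\<bar>) = 2 * (\<Sum>x\<leftarrow>as. \<bar>x\<bar>)"
  "(\<forall>x\<in>set (blocks as). d dvd x) \<longleftrightarrow> (\<forall>x\<in>set as. d dvd x)"
  by (induction as) auto

text \<open>Reducing \<open>a\<close> modulo \<open>s = a + b\<close> leaves two entries weakly of
  the sign of \<open>s\<close>. Their absolute values add up to \<open>\<bar>s\<bar>\<close>, which
  is less than before because \<open>a\<close> and \<open>b\<close> have opposite signs.\<close>

lemma same_sign_pair:
  fixes a b :: int
  assumes "a * b < 0" and "a + b \<noteq> 0"
  shows "\<exists>a' b'. [a, b] \<approx> [a', b'] \<and> \<bar>a'\<bar> + \<bar>b'\<bar> < \<bar>a\<bar> + \<bar>b\<bar>"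
proof -
  define s where "s = a + b"
  define a' where "a' = a mod s"
  have "[a, b] \<approx> [a + - (a div s) * s, b - - (a div s) * s]"
    unfolding s_def by (rule burau_equiv_pair)
  also have "[a + - (a div s) * s, b - - (a div s) * s] = [a', s - a']"
    by (simp add: a'_def s_def minus_div_mult_eq_mod[symmetric])
  finally have 1: "[a, b] \<approx> [a', s - a']" .
  \<comment> \<open>The result of \<open>mod\<close> takes the sign of the divisor.\<close>
  have "s > 0 \<Longrightarrow> 0 \<le> a' \<and> a' < s" "s < 0 \<Longrightarrow> s < a' \<and> a' \<le> 0"
    by (simp_all add: a'_def)
  then have "\<bar>a'\<bar> + \<bar>s - a'\<bar> = \<bar>s\<bar>" using assms(2) by (cases "s > 0") (auto simp: s_def)
  also have "\<dots> < \<bar>a\<bar> + \<bar>b\<bar>" using assms(1) by (auto simp: s_def mult_less_0_iff)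
  finally show ?thesis using 1 by blast
qed


definition abs_sum :: "int list \<Rightarrow> int" where
  "abs_sum xs = (\<Sum>x\<leftarrow>xs. \<bar>x\<bar>)"

lemma abs_sum_simps [simp]:
  "abs_sum [] = 0" "abs_sum (x # xs) = \<bar>x\<bar> + abs_sum xs"
  "abs_sum (xs @ ys) = abs_sum xs + abs_sum ys" "abs_sum (blocks as) = 2 * abs_sum as"
  "abs_sum (replicate m 0) = 0"
  by (simp_all add: abs_sum_def sum_list_replicate)

lemma abs_sum_nonneg [simp]: "0 \<le> abs_sum xs"
  by (induction xs) auto

text \<open>The tail is normalized first and the head then merged into it. Merging may shrink a pair
  and start again on the whole list; the bound on \<open>abs_sum\<close> is part of the claim so
  that the lexicographic measure drops then.\<close>

lemma burau_equiv_normal_form: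
  "\<exists>ps as m. xs \<approx> ps @ blocks as @ replicate m 0 \<and>
    ((\<forall>p\<in>set ps. p > 0) \<or> (\<forall>p\<in>set ps. p < 0)) \<and>
    abs_sum (ps @ blocks as) \<le> abs_sum xs"
proof (induction xs rule: wf_induct_rule[OF wf_measures[of "[\<lambda>xs. nat (abs_sum xs), length]"]])
  case (1 xs)
  show ?case
  proof (cases xs)
    case Nil
    then have "xs \<approx> [] @ blocks [] @ replicate 0 0" by simp
    then show ?thesis using Nil by (intro exI[of _ "[]"] exI[of _ 0]) simp
  next
    case (Cons x ys)
    then have "(ys, xs) \<in> measures [\<lambda>xs. nat (abs_sum xs), length]"
      by auto
    from 1[OF this] obtain ps as m where nf: "ys \<approx> ps @ blocks as @ replicate m 0"
      "(\<forall>p\<in>set ps. p > 0) \<or> (\<forall>p\<in>set ps. p < 0)" "abs_sum (ps @ blocks as) \<le> abs_sum ys"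
      by blast
    have xs: "xs \<approx> x # ps @ blocks as @ replicate m 0"
      unfolding Cons by (rule burau_equiv_Cons[OF nf(1)])
    \<comment> \<open>The head is zero, or has the sign of \<open>ps\<close>, or forms a block with
      the next entry, or has the opposite sign without cancelling that entry.\<close>
    consider "x = 0" | "x \<noteq> 0" "(\<forall>p\<in>set (x # ps). p > 0) \<or> (\<forall>p\<in>set (x # ps). p < 0)"
      | p qs where "ps = p # qs" "p = - x" | p qs where "ps = p # qs" "x * p < 0" "x + p \<noteq> 0"
    proof (cases ps)
      case Nil
      then show ?thesis using that(1,2) by (cases x "0 :: int" rule: linorder_cases) auto
    next
      case (Cons p qs)
      then show ?thesis using that(1,2) that(3)[of p qs] that(4)[of p qs] nf(2)
        by (cases x "0 :: int" rule: linorder_cases; cases "p = - x")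
          (auto simp: mult_less_0_iff)
    qed
    then show ?thesis
    proof cases
      assume "x = 0"
      note xs
      also have "x # ps @ blocks as @ replicate m 0 \<approx> (ps @ blocks as @ replicate m 0) @ [0]"
        unfolding \<open>x = 0\<close> by (rule burau_equiv_move_zero)
      also have "(ps @ blocks as @ replicate m 0) @ [0] = ps @ blocks as @ replicate (Suc m) 0"
        by (simp add: replicate_append_same)
      finally show ?thesis using nf(2,3) Cons by (intro exI[of _ ps] exI[of _ as] exI[of _ "Suc m"]) auto
    next
      assume "(\<forall>p\<in>set (x # ps). p > 0) \<or> (\<forall>p\<in>set (x # ps). p < 0)"
      then show ?thesis using nf(3) Cons xs
        by (intro exI[of _ "x # ps"] exI[of _ as] exI[of _ m]) auto
    next
      fix p qs assume ps: "ps = p # qs" "p = - x"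
      obtain b where b: "\<bar>b\<bar> = \<bar>x\<bar>" "[x, - x] @ qs \<approx> qs @ [b, - b]"
        using burau_equiv_move_block by blast
      note xs
      also have "x # ps @ blocks as @ replicate m 0 \<approx> qs @ blocks (b # as) @ replicate m 0"
        using burau_equiv_context[OF b(2), of "[]" "blocks as @ replicate m 0"] ps by simp
      finally show ?thesis using nf(2,3) Cons b ps
        by (intro exI[of _ qs] exI[of _ "b # as"] exI[of _ m]) auto
    next
      fix p qs assume ps: "ps = p # qs" "x * p < 0" "x + p \<noteq> 0"
      obtain a' b' where ab: "[x, p] \<approx> [a', b']" "\<bar>a'\<bar> + \<bar>b'\<bar> < \<bar>x\<bar> + \<bar>p\<bar>"
        using same_sign_pair[OF ps(2,3)] by blast
      define zs where "zs = [a', b'] @ qs @ blocks as @ replicate m 0"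
      note xs
      also have "x # ps @ blocks as @ replicate m 0 \<approx> zs"
        using burau_equiv_context[OF ab(1), of "[]" "qs @ blocks as @ replicate m 0"] ps
        by (simp add: zs_def)
      finally have xz: "xs \<approx> zs" .
      have lt: "abs_sum zs < abs_sum xs"
        using ab(2) nf(3) ps Cons by (simp add: zs_def)
      then have "(zs, xs) \<in> measures [\<lambda>xs. nat (abs_sum xs), length]"
        using le_less_trans[OF abs_sum_nonneg[of zs] lt] by simp
      from 1[OF this] obtain ps as m where nf: "zs \<approx> ps @ blocks as @ replicate m 0"
        "(\<forall>p\<in>set ps. p > 0) \<or> (\<forall>p\<in>set ps. p < 0)" "abs_sum (ps @ blocks as) \<le> abs_sum zs"
        by blast
      with xz lt burau_equiv.trans[OF xz nf(1)] show ?thesis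
        by (intro exI[of _ ps] exI[of _ as] exI[of _ m]) simp
    qed
  qed
qed

section \<open>Even length: removing the blocks\<close>

text \<open>The total is 1, so the full twist, taken \<open>a / 2\<close> times, clears the two
  middle entries and leaves \<open>1 + a\<close> and \<open>- a\<close> outside. These form a pair
  of sum 1, which reduces to \<open>1, 0\<close>.\<close>

lemma burau_equiv_kill_block:
  assumes "even a"
  shows "[1, a, - a, 0] \<approx> [1, 0, 0, 0]"
proof -
  obtain k where k: "a = 2 * k" using assms by blast
  have "[1, a, - a, 0] \<approx> [1 + a, 0, 0, - a]"
    using burau_equiv_quad[of 1 1 a "- a" 0 k] k by simp
  also have "\<dots> = [1 + a] @ replicate 2 0 @ [- a]" by (simp add: numeral_2_eq_2)
  also have "\<dots> \<approx> [1 + a] @ [- a] @ replicate 2 0"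
    using burau_equiv_context[OF burau_equiv_move_zeros[of 2 "[- a]"], of "[1 + a]" "[]"] by simp
  also have "\<dots> \<approx> [1, 0] @ replicate 2 0"
    using burau_equiv_context[OF burau_equiv_pair[of "1 + a" "- a" "- a"], of "[]" "replicate 2 0"]
    by simp
  finally show ?thesis by (simp add: numeral_2_eq_2)
qed

text \<open>The zero at the end is brought next to the first block, which turns into two more zeros;
  a zero is thus still available for the next block.\<close>

lemma burau_equiv_kill_blocks:
  assumes "\<forall>a\<in>set as. even a"
  shows "1 # blocks as @ [0] \<approx> 1 # replicate (2 * length as + 1) 0"
  using assms
proof (induction as)
  case (Cons a as)
  have "1 # blocks (a # as) @ [0] \<approx> [1, a, - a] @ 0 # blocks as"
    using burau_equiv_context[OF burau_equiv.sym[OF burau_equiv_move_zero[of "blocks as"]],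
        of "[1, a, - a]" "[]"] by simp
  also have "\<dots> \<approx> [1, 0, 0, 0] @ blocks as"
    using burau_equiv_context[OF burau_equiv_kill_block[of a], of "[]" "blocks as"] Cons.prems by simp
  also have "\<dots> \<approx> 1 # (blocks as @ [0]) @ replicate 2 0"
    using burau_equiv_context[OF burau_equiv_move_zeros[of 3 "blocks as"], of "[1]" "[]"]
    by (simp add: eval_nat_numeral)
  also have "\<dots> \<approx> (1 # replicate (2 * length as + 1) 0) @ replicate 2 0"
    using burau_equiv_append[OF Cons.IH, of "replicate 2 0" "replicate 2 0"] Cons.prems by simp
  finally show ?case by (simp add: replicate_add[symmetric] flip: replicate_Suc)
qed simp

text \<open>Sum 1 forces the one-signed part to be \<open>[1]\<close>. This is the only odd entry,
  so the blocks are even, and the parity of the length leaves at least one zero to remove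
  them.\<close>

lemma burau_equiv_even_length:
  assumes "even (length xs)" "sum_list xs = 1" "length (filter odd xs) = 1"
  shows "xs \<approx> replicate (length xs - 1) 0 @ [1]"
proof -
  obtain ps as m where nf: "xs \<approx> ps @ blocks as @ replicate m 0"
      "(\<forall>p\<in>set ps. p > 0) \<or> (\<forall>p\<in>set ps. p < 0)"
    using burau_equiv_normal_form by blast
  have "sum_list ps = 1"
    using burau_equiv_sum_list[OF nf(1)] assms(2) by (simp add: sum_list_replicate)
  have nonneg: "sum_list qs \<ge> 0" if "\<forall>p\<in>set qs. p > 0" for qs :: "int list"
    using that by (induction qs) auto
  have nonpos: "sum_list qs \<le> 0" if "\<forall>p\<in>set qs. p < 0" for qs :: "int list"
    using that by (induction qs) auto
  have pos: "sum_list qs > 0" if "\<forall>p\<in>set qs. p > 0" "qs \<noteq> []" for qs :: "int list"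
    using that nonneg[of "tl qs"] by (cases qs) auto
  have "ps = [1]"
  proof (cases ps)
    case (Cons p qs)
    then have "\<forall>p\<in>set ps. p > 0" using nf(2) nonpos[of ps] \<open>sum_list ps = 1\<close> by auto
    then show ?thesis using Cons pos[of qs] \<open>sum_list ps = 1\<close> by (cases "qs = []") auto
  qed (use \<open>sum_list ps = 1\<close> in simp)
  have "filter odd (replicate m (0 :: int)) = []" by simp
  then have "\<forall>a\<in>set as. even a"
    using burau_equiv_odd[OF nf(1)] assms(3) \<open>ps = [1]\<close> by (simp add: filter_empty_conv)
  have len: "length xs = 1 + 2 * length as + m"
    using burau_equiv_length[OF nf(1)] \<open>ps = [1]\<close> by simp
  then obtain m' where m: "m = Suc m'" using assms(1) by (cases m) auto
  have "xs \<approx> (1 # blocks as @ [0]) @ replicate m' 0"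
    using nf(1) \<open>ps = [1]\<close> m by simp
  also have "\<dots> \<approx> (1 # replicate (2 * length as + 1) 0) @ replicate m' 0"
    by (intro burau_equiv_append burau_equiv_kill_blocks) (use \<open>\<forall>a\<in>set as. even a\<close> in auto)
  also have "\<dots> = [1] @ replicate (length xs - 1) 0"
    unfolding len m by (simp add: replicate_add[symmetric] flip: replicate_Suc)
  also have "\<dots> \<approx> replicate (length xs - 1) 0 @ [1]"
    by (rule burau_equiv.sym[OF burau_equiv_move_zeros])
  finally show ?thesis .
qed

section \<open>Odd length: a Euclidean algorithm on the blocks\<close>

text \<open>With the zero in front, the full twist acts on \<open>[0, a, - a, b]\<close>, whose
  total is \<open>b\<close>, and so changes \<open>a\<close> by an even multiple of
  \<open>b\<close>. The other moves restore the second block, the zero and the sign.\<close>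

lemma burau_equiv_blocks_Euclid: "[a, - a, b, - b, 0] \<approx> [a - 2 * k * b, - (a - 2 * k * b), b, - b, 0]"
proof -
  define c where "c = a - 2 * k * b"
  have "[a, - a, b, - b, 0] \<approx> 0 # [a, - a, b, - b]"
    using burau_equiv.sym[OF burau_equiv_move_zero[of "[a, - a, b, - b]"]] by simp
  also have "\<dots> \<approx> [2 * (k * b), c, - c, b - 2 * (k * b), - b]"
    using burau_equiv_context[OF burau_equiv_quad[of b 0 a "- a" b k], of "[]" "[- b]"]
    by (simp add: c_def algebra_simps)
  also have "\<dots> \<approx> [- c, c, 2 * (k * b), b - 2 * (k * b), - b]"
    using burau_equiv_context[OF burau_equiv.sym[OF burau_equiv_move_block1[of "- c" "2 * (k * b)"]],
        of "[]" "[b - 2 * (k * b), - b]"] by simp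
  also have "\<dots> \<approx> [- c, c, 0, b, - b]"
    using burau_equiv_context[OF burau_equiv_pair[of "2 * (k * b)" "b - 2 * (k * b)" "- 2 * k"],
        of "[- c, c]" "[- b]"] by (simp add: algebra_simps)
  also have "\<dots> \<approx> [c, - c, 0, b, - b]"
    using burau_equiv_context[OF burau_equiv_flip_block[of "- c"], of "[]" "[b, - b]"] by simp
  also have "\<dots> \<approx> [c, - c, b, - b, 0]"
    using burau_equiv_context[OF burau_equiv_move_zero[of "[b, - b]"], of "[c, - c]" "[]"] by simp
  finally show ?thesis unfolding c_def .
qed

lemma adjacent_distinct:
  "(\<exists>g. \<forall>a\<in>set as. f a = g) \<or> (\<exists>us a b vs. as = us @ [a, b] @ vs \<and> f a \<noteq> f b)"
proof (induction as)
  case (Cons a as)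
  show ?case
  proof (cases "\<exists>us b c vs. as = us @ [b, c] @ vs \<and> f b \<noteq> f c")
    case True
    then show ?thesis by (metis append_Cons)
  next
    case False
    then obtain g where g: "\<forall>a\<in>set as. f a = g" using Cons.IH by blast
    show ?thesis
    proof (cases as)
      case (Cons b bs)
      then have "a # as = [] @ [a, b] @ bs" by simp
      then show ?thesis using g Cons by (metis set_ConsD list.set_intros(1))
    qed simp
  qed
qed simp

text \<open>Only even multiples of \<open>b\<close> are available. Moving \<open>a\<close> by
  \<open>2 * \<bar>b\<bar>\<close> towards zero may pass zero, but then by less than
  \<open>\<bar>a\<bar>\<close>.\<close>

lemma abs_reduce:
  fixes a b :: int
  assumes "\<bar>b\<bar> < \<bar>a\<bar>" "b \<noteq> 0"
  obtains k where "\<bar>a - 2 * k * b\<bar> < \<bar>a\<bar>"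
proof (cases "a * b > 0")
  case True
  then show ?thesis using that[of 1] assms by (auto simp: zero_less_mult_iff)
next
  case False
  then show ?thesis using that[of "- 1"] assms by (auto simp: zero_less_mult_iff)
qed

text \<open>The zero is fetched to each block in turn and reverses its sign if necessary. The value
  -1 is the one that matches the vector \<open>e_n - v_n\<close>, see
  \<open>blocks_replicate\<close>.\<close>

lemma burau_equiv_flip_blocks:
  assumes "\<forall>a\<in>set as. \<bar>a\<bar> = 1"
  shows "blocks as @ [0] \<approx> blocks (replicate (length as) (- 1)) @ [0]"
  using assms
proof (induction as)
  case (Cons a as)
  have "[a, - a] @ blocks as @ [0] \<approx> [a, - a, 0] @ blocks as"
    using burau_equiv_context[OF burau_equiv.sym[OF burau_equiv_move_zero[of "blocks as"]],
        of "[a, - a]" "[]"] by simp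
  also have "\<dots> \<approx> [- 1, 1, 0] @ blocks as"
  proof (cases "a = 1")
    case True
    then show ?thesis
      using burau_equiv_context[OF burau_equiv_flip_block[of 1], of "[]" "blocks as"] by simp
  next
    case False
    then have "a = - 1" using Cons.prems by auto
    then show ?thesis by simp
  qed
  also have "\<dots> \<approx> [- 1, 1] @ blocks as @ [0]"
    using burau_equiv_context[OF burau_equiv_move_zero[of "blocks as"], of "[- 1, 1]" "[]"] by simp
  also have "\<dots> \<approx> [- 1, 1] @ blocks (replicate (length as) (- 1)) @ [0]"
    using burau_equiv_append[OF burau_equiv.refl Cons.IH, of "[- 1, 1]"] Cons.prems by simp
  finally show ?case by simp
qed simp

text \<open>If all absolute values agree, primitivity makes them 1; otherwise two neighbouring
  blocks differ in size and the larger one shrinks. Oddness rules out zero divisors and persists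
  because the number of odd entries is invariant.\<close>

lemma burau_equiv_primitive_blocks:
  assumes "\<forall>a\<in>set as. odd a" and "\<And>d. \<forall>a\<in>set as. d dvd a \<Longrightarrow> d dvd 1"
  shows "blocks as @ [0] \<approx> blocks (replicate (length as) (- 1)) @ [0]"
  using assms
proof (induction "nat (abs_sum as)" arbitrary: as rule: less_induct)
  case less
  consider g where "\<forall>a\<in>set as. \<bar>a\<bar> = g"
    | us a b vs where "as = us @ [a, b] @ vs" "\<bar>a\<bar> \<noteq> \<bar>b\<bar>"
    using adjacent_distinct[of as abs] by blast
  then show ?case
  proof cases
    fix g assume g: "\<forall>a\<in>set as. \<bar>a\<bar> = g"
    then have "\<forall>a\<in>set as. g dvd a" by auto
    then have "g dvd 1" by (rule less.prems(2))
    then have "\<forall>a\<in>set as. \<bar>a\<bar> = 1" using g by auto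
    then show ?case by (rule burau_equiv_flip_blocks)
  next
    fix us a b vs assume as: "as = us @ [a, b] @ vs" "\<bar>a\<bar> \<noteq> \<bar>b\<bar>"
    have "\<exists>a' b'. [a, - a, b, - b, 0] \<approx> [a', - a', b', - b', 0] \<and> \<bar>a'\<bar> + \<bar>b'\<bar> < \<bar>a\<bar> + \<bar>b\<bar>"
      (is "\<exists>a' b'. ?P a b a' b'")
    proof -
      have red: "\<exists>a' b'. ?P a b a' b'" if ab: "\<bar>b\<bar> < \<bar>a\<bar>" "odd b" for a b :: int
      proof -
        obtain k where "\<bar>a - 2 * k * b\<bar> < \<bar>a\<bar>" by (rule abs_reduce[of b a]) (use ab in auto)
        then show ?thesis using burau_equiv_blocks_Euclid[of a b k]
          by (intro exI[of _ "a - 2 * k * b"] exI[of _ b]) simp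
      qed
      consider "\<bar>b\<bar> < \<bar>a\<bar>" | "\<bar>a\<bar> < \<bar>b\<bar>" using as(2) by linarith
      then show ?thesis
      proof cases
        case 1
        then show ?thesis using red less.prems(1) as by simp
      next
        case 2
        \<comment> \<open>The larger block has to stand first, so the two are exchanged
          beforehand.\<close>
        then have "\<exists>a' b'. ?P b a a' b'" using less.prems(1) as by (intro red) auto
        then obtain a' b' where "?P b a a' b'" by blast
        moreover have "[a, - a, b, - b, 0] \<approx> [b, - b, a, - a, 0]"
          using burau_equiv_append[OF burau_equiv_swap_blocks[of a b] burau_equiv.refl, of "[0]"]
          by simp
        ultimately show ?thesis
          by (intro exI[of _ a'] exI[of _ b']) (auto intro: burau_equiv.trans)
      qed
    qed
    then obtain a' b' where ab: "[a, - a, b, - b, 0] \<approx> [a', - a', b', - b', 0]"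
      "\<bar>a'\<bar> + \<bar>b'\<bar> < \<bar>a\<bar> + \<bar>b\<bar>" by blast
    define bs where "bs = us @ [a', b'] @ vs"
    have "blocks as @ [0] \<approx> blocks us @ [a, - a, b, - b, 0] @ blocks vs"
      using burau_equiv_context[OF burau_equiv.sym[OF burau_equiv_move_zero[of "blocks vs"]],
          of "blocks us @ [a, - a, b, - b]" "[]"] as by simp
    also have "\<dots> \<approx> blocks us @ [a', - a', b', - b', 0] @ blocks vs"
      by (rule burau_equiv_context[OF ab(1)])
    also have "\<dots> \<approx> blocks bs @ [0]"
      using burau_equiv_context[OF burau_equiv_move_zero[of "blocks vs"],
          of "blocks us @ [a', - a', b', - b']" "[]"] by (simp add: bs_def)
    finally have eq: "blocks as @ [0] \<approx> blocks bs @ [0]" .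
    have len: "length bs = length as" by (simp add: bs_def as)
    have "length (filter odd bs) = length bs"
      using burau_equiv_odd[OF eq] less.prems(1) len by simp
    then have "\<forall>a\<in>set bs. odd a" by (metis filter_id_conv length_filter_less less_irrefl)
    moreover have "(\<forall>b\<in>set bs. d dvd b) \<longleftrightarrow> (\<forall>a\<in>set as. d dvd a)" for d
      using burau_equiv_dvd[OF eq, of d] by (auto simp: ball_Un)
    moreover have "nat (abs_sum bs) < nat (abs_sum as)"
    proof -
      have lt: "abs_sum bs < abs_sum as" using ab(2) by (simp add: bs_def as)
      then show ?thesis using le_less_trans[OF abs_sum_nonneg[of bs] lt] by simp
    qed
    ultimately have "blocks bs @ [0] \<approx> blocks (replicate (length bs) (- 1)) @ [0]"
      using less.prems(2) by (intro less.hyps) auto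
    with eq show ?case unfolding len by (rule burau_equiv.trans)
  qed
qed

text \<open>Sum 0 leaves no one-signed part. The odd length forces a zero; as only one entry is
  even, there is exactly one zero and all blocks are odd.\<close>

lemma burau_equiv_odd_length:
  assumes "odd (length xs)" "sum_list xs = 0" "length (filter odd xs) = length xs - 1"
    and "\<And>d. \<forall>x\<in>set xs. d dvd x \<Longrightarrow> d dvd 1"
  shows "xs \<approx> blocks (replicate (length xs div 2) (- 1)) @ [0]"
proof -
  obtain ps as m where nf: "xs \<approx> ps @ blocks as @ replicate m 0"
      "(\<forall>p\<in>set ps. p > 0) \<or> (\<forall>p\<in>set ps. p < 0)"
    using burau_equiv_normal_form by blast
  have "sum_list ps = 0"
    using burau_equiv_sum_list[OF nf(1)] assms(2) by (simp add: sum_list_replicate)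
  have "sum_list qs \<ge> 0" if "\<forall>p\<in>set qs. p > 0" for qs :: "int list"
    using that by (induction qs) auto
  moreover have "sum_list qs \<le> 0" if "\<forall>p\<in>set qs. p < 0" for qs :: "int list"
    using that by (induction qs) auto
  ultimately have "ps = []" using \<open>sum_list ps = 0\<close> nf(2)
    by (cases ps) (fastforce simp: add_nonneg_eq_0_iff)+
  have len: "length xs = 2 * length as + m"
    using burau_equiv_length[OF nf(1)] \<open>ps = []\<close> by simp
  have "length xs - 1 = 2 * length (filter odd as)"
    using burau_equiv_odd[OF nf(1)] assms(3) \<open>ps = []\<close> by simp
  moreover have "length (filter odd as) \<le> length as" by simp
  moreover have "odd m" using len assms(1) by simp
  ultimately have m: "m = 1" and "length (filter odd as) = length as"
    using len odd_pos[of m] by linarith+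
  then have "\<forall>a\<in>set as. odd a" by (metis filter_id_conv length_filter_less less_irrefl)
  have eq: "xs \<approx> blocks as @ [0]" using nf(1) \<open>ps = []\<close> m by simp
  also have "\<dots> \<approx> blocks (replicate (length as) (- 1)) @ [0]"
    using \<open>\<forall>a\<in>set as. odd a\<close>
  proof (rule burau_equiv_primitive_blocks)
    fix d assume "\<forall>a\<in>set as. d dvd a"
    then show "d dvd 1" using burau_equiv_dvd[OF eq, of d] assms(4)[of d] by (simp add: ball_Un)
  qed
  finally show ?thesis using len m by simp
qed

section \<open>The image of the Burau representation\<close>

definition burau_image :: "nat \<Rightarrow> int mat set" where
  "burau_image n = burau n ` carrier (braid_group n)"

lemma burau_image_words: "burau_image n = word_eval (GL n) (burau_gen n) ` braid_words n"
  unfolding burau_image_def carrier_braid_group image_image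
  by (simp add: burau_class)

lemma subgroup_burau_image: "subgroup (burau_image n) (GL n)"
  unfolding burau_image_def
  by (intro group_hom.img_is_subgroup group_hom.intro group_hom_axioms.intro
      braid_group_is_group GL_group burau_hom)

lemma burau_image_Gamma: "M \<in> burau_image n \<Longrightarrow> M \<in> Gamma n"
  by (auto simp: burau_image_def burau_Gamma)

lemma Gamma_carrier: "A \<in> Gamma n \<Longrightarrow> A \<in> carrier_mat n n"
  by (auto simp: Gamma_def GL_simps)

lemma burau_image_carrier: "M \<in> burau_image n \<Longrightarrow> M \<in> carrier_mat n n"
  by (simp add: burau_image_Gamma Gamma_carrier)

lemma burau_image_one: "1\<^sub>m n \<in> burau_image n"
  using subgroup.one_closed[OF subgroup_burau_image, of n] by (simp add: GL_simps(3))

lemma burau_image_mult: "A \<in> burau_image n \<Longrightarrow> B \<in> burau_image n \<Longrightarrow> A * B \<in> burau_image n"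
  using subgroup.m_closed[OF subgroup_burau_image, of A n B] by (simp add: GL_simps(2))

lemma burau_gen_image: "1 \<le> i \<Longrightarrow> i < n \<Longrightarrow> burau_gen n i \<in> burau_image n"
  unfolding burau_image_words
  using right_mult_one_mat[OF burau_gen_carrier[of i n]]
  by (intro image_eqI[of _ _ "[(i, True)]"]) (auto simp: GL_simps(2,3))

lemma Gamma_inverse:
  assumes "A \<in> Gamma n"
  obtains B where "B \<in> Gamma n" "B * A = 1\<^sub>m n" "A * B = 1\<^sub>m n"
proof (rule that)
  have "A \<in> carrier (GL n)" using assms by (simp add: Gamma_def)
  then show "inv\<^bsub>GL n\<^esub> A * A = 1\<^sub>m n" "A * inv\<^bsub>GL n\<^esub> A = 1\<^sub>m n" by (simp_all add: inv_GL)
qed (rule subgroup.m_inv_closed[OF subgroup_Gamma assms])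

lemma burau_image_inverse:
  assumes "A \<in> burau_image n"
  obtains B where "B \<in> burau_image n" "B * A = 1\<^sub>m n" "A * B = 1\<^sub>m n"
proof (rule that)
  have "A \<in> carrier (GL n)" using assms subgroup.subset[OF subgroup_burau_image] by blast
  then show "inv\<^bsub>GL n\<^esub> A * A = 1\<^sub>m n" "A * inv\<^bsub>GL n\<^esub> A = 1\<^sub>m n" by (simp_all add: inv_GL)
qed (rule subgroup.m_inv_closed[OF subgroup_burau_image assms])

lemma burau_image_cancel:
  assumes "M \<in> burau_image n" "M * A \<in> burau_image n" "A \<in> carrier_mat n n"
  shows "A \<in> burau_image n"
proof -
  obtain B where B: "B \<in> burau_image n" "B * M = 1\<^sub>m n" by (rule burau_image_inverse[OF assms(1)])
  have "B * (M * A) = A"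
    using assoc_mult_mat[OF burau_image_carrier[OF B(1)] burau_image_carrier[OF assms(1)] assms(3)]
      B(2) assms(3) by simp
  then show ?thesis using burau_image_mult[OF B(1) assms(2)] by simp
qed

section \<open>From lists back to column vectors\<close>

definition alt_vec :: "int list \<Rightarrow> int vec" where
  "alt_vec xs = vec (length xs) (\<lambda>i. (- 1) ^ i * xs ! i)"

lemma alt_vec_carrier [simp]: "alt_vec xs \<in> carrier_vec (length xs)"
  by (simp add: alt_vec_def)

text \<open>The alternating sign turns \<open>(x, y) \<mapsto> (2 * x - y, x)\<close> into a step.
  Generators are numbered from 1 and act on rows \<open>i - 1\<close> and \<open>i\<close>, whence
  \<open>Suc (length us)\<close>.\<close>

lemma alt_vec_step:
  fixes us vs :: "int list" and a b :: int
  defines "n \<equiv> length (us @ [a, b] @ vs)" and "i \<equiv> Suc (length us)"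
  shows "burau_gen n i *\<^sub>v alt_vec (us @ [a, b] @ vs) = alt_vec (us @ [2 * a + b, - a] @ vs)"
proof (rule eq_vecI)
  have i: "1 \<le> i" "i < n" by (simp_all add: n_def i_def)
  fix r assume "r < dim_vec (alt_vec (us @ [2 * a + b, - a] @ vs))"
  then have r: "r < n" by (simp add: alt_vec_def n_def)
  have x: "alt_vec (us @ [a, b] @ vs) \<in> carrier_vec n" unfolding n_def by (rule alt_vec_carrier)
  show "(burau_gen n i *\<^sub>v alt_vec (us @ [a, b] @ vs)) $ r = alt_vec (us @ [2 * a + b, - a] @ vs) $ r"
    unfolding burau_gen_mult_vec_index[OF i x r] using r
    by (auto simp: alt_vec_def n_def i_def nth_append nth_Cons' algebra_simps)
qed (use burau_gen_carrier[of i n] in \<open>simp add: n_def i_def alt_vec_def\<close>)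

text \<open>A step is a generator; symmetry and transitivity become inverses and products in the
  image.\<close>

lemma burau_equiv_image:
  "xs \<approx> ys \<Longrightarrow> \<exists>M\<in>burau_image (length xs). M *\<^sub>v alt_vec xs = alt_vec ys"
proof (induction rule: burau_equiv.induct)
  case (step us a b vs)
  show ?case
    using alt_vec_step[of us a b vs] burau_gen_image[of "Suc (length us)" "length (us @ [a, b] @ vs)"]
    by auto
next
  case (refl xs)
  show ?case by (intro bexI[of _ "1\<^sub>m (length xs)"]) (auto simp: burau_image_one)
next
  case (sym xs ys)
  then obtain M where M: "M \<in> burau_image (length xs)" "M *\<^sub>v alt_vec xs = alt_vec ys" by blast
  obtain B where B: "B \<in> burau_image (length xs)" "B * M = 1\<^sub>m (length xs)"
    by (rule burau_image_inverse[OF M(1)])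
  have "B *\<^sub>v alt_vec ys = B * M *\<^sub>v alt_vec xs"
    using assoc_mult_mat_vec[OF burau_image_carrier[OF B(1)] burau_image_carrier[OF M(1)]] M(2) by simp
  also have "\<dots> = alt_vec xs" unfolding B(2) by (rule one_mult_mat_vec[OF alt_vec_carrier])
  finally show ?case using B burau_equiv_length[OF sym.hyps] by auto
next
  case (trans xs ys zs)
  obtain M where M: "M \<in> burau_image (length xs)" "M *\<^sub>v alt_vec xs = alt_vec ys"
    using trans.IH(1) by blast
  obtain L where L: "L \<in> burau_image (length xs)" "L *\<^sub>v alt_vec ys = alt_vec zs"
    using trans.IH(2) burau_equiv_length[OF trans.hyps(1)] by auto
  have "L * M *\<^sub>v alt_vec xs = alt_vec zs"
    using assoc_mult_mat_vec[OF burau_image_carrier[OF L(1)] burau_image_carrier[OF M(1)]] M L by simp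
  then show ?case using burau_image_mult[OF L(1) M(1)] by blast
qed

section \<open>Linear constraints and parity of matrix entries\<close>

lemma Gamma_entries:
  assumes "A \<in> Gamma n"
  shows "i < n \<Longrightarrow> (\<Sum>j<n. A $$ (i, j)) = 1"
    and "j < n \<Longrightarrow> (\<Sum>i<n. (- 1) ^ i * A $$ (i, j)) = (- 1) ^ j"
proof -
  have A: "A \<in> carrier_mat n n" "A *\<^sub>v v_vec n = v_vec n"
    "mat_of_row (w_vec n) * A = mat_of_row (w_vec n)"
    using assms by (auto simp: Gamma_def GL_simps)
  show "(\<Sum>j<n. A $$ (i, j)) = 1" if "i < n"
    using arg_cong[OF A(2), of "\<lambda>x. x $ i"] that A(1)
    by (simp add: v_vec_def scalar_prod_def atLeast0LessThan)
  show "(\<Sum>i<n. (- 1) ^ i * A $$ (i, j)) = (- 1) ^ j" if "j < n"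
    using arg_cong[OF A(3), of "\<lambda>x. x $$ (0, j)"] that A(1)
    by (simp add: w_vec_def mat_of_row_def scalar_prod_def atLeast0LessThan)
qed

text \<open>All matrices in the image are permutation matrices modulo \<open>2\<close>; this is the column-wise part of
  that condition.\<close>

definition odd_monomial :: "nat \<Rightarrow> int mat \<Rightarrow> bool" where
  "odd_monomial n A \<longleftrightarrow> (\<forall>c<n. \<exists>!r. r < n \<and> odd (A $$ (r, c)))"

lemma ex1_involution:
  assumes "\<And>r. t (t r) = r" and "\<And>r. Q r \<longleftrightarrow> P (t r)" and "\<exists>!r. P r"
  shows "\<exists>!r. Q r"
  using assms by metis

text \<open>Modulo 2 a generator and its inverse both exchange the rows \<open>i - 1\<close> and
  \<open>i\<close>.\<close>

lemma odd_monomial_gen: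
  assumes i: "1 \<le> i" "i < n" and A: "A \<in> carrier_mat n n" "odd_monomial n A"
  shows "odd_monomial n (burau_gen n i * A)" "odd_monomial n (burau_gen_inv n i * A)"
proof -
  let ?t = "transpose (i - 1) i"
  have t: "r < n \<and> P r \<longleftrightarrow> ?t r < n \<and> Q (?t r)" if "\<And>r. r < n \<Longrightarrow> P r = Q (?t r)" for r P Q
    using that[of r] i by (auto simp: transpose_def)
  have ex1: "\<exists>!r. r < n \<and> P r" if "\<exists>!r. r < n \<and> Q r" "\<And>r. r < n \<Longrightarrow> P r = Q (?t r)" for P Q
    by (rule ex1_involution[of ?t, OF _ t[of P Q] that(1)]) (auto simp: that(2))
  have d: "dim_row A = n" "dim_col A = n" using A(1) by auto
  have "(\<exists>!r. r < n \<and> odd ((burau_gen n i * A) $$ (r, c))) \<and>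
      (\<exists>!r. r < n \<and> odd ((burau_gen_inv n i * A) $$ (r, c)))" if c: "c < n" for c
  proof
    from c have Q: "\<exists>!r. r < n \<and> odd (A $$ (r, c))" using A(2) by (simp add: odd_monomial_def)
    have "odd ((burau_gen n i * A) $$ (r, c)) \<longleftrightarrow> odd (A $$ (?t r, c))" if "r < n" for r
      using that c i d
      by (subst burau_gen_mult_index) (auto simp: transpose_def)
    with Q show "\<exists>!r. r < n \<and> odd ((burau_gen n i * A) $$ (r, c))" by (rule ex1)
    have "odd ((burau_gen_inv n i * A) $$ (r, c)) \<longleftrightarrow> odd (A $$ (?t r, c))" if "r < n" for r
      using that c i d
      by (subst burau_gen_inv_mult_index) (auto simp: transpose_def)
    with Q show "\<exists>!r. r < n \<and> odd ((burau_gen_inv n i * A) $$ (r, c))" by (rule ex1)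
  qed
  then show "odd_monomial n (burau_gen n i * A)" "odd_monomial n (burau_gen_inv n i * A)"
    by (simp_all add: odd_monomial_def)
qed

lemma odd_monomial_image:
  assumes "M \<in> burau_image n" "A \<in> carrier_mat n n" "odd_monomial n A"
  shows "odd_monomial n (M * A)"
proof -
  obtain w where w: "w \<in> braid_words n" "M = word_eval (GL n) (burau_gen n) w"
    using assms(1) by (auto simp: burau_image_words)
  have "odd_monomial n (word_eval (GL n) (burau_gen n) w * A)" using w(1)
  proof (induction w)
    case Nil
    then show ?case using assms(2,3) by (simp add: GL_simps(3))
  next
    case (Cons x w)
    obtain i b where x: "x = (i, b)" by (cases x)
    then have i: "1 \<le> i" "i < n" and w: "w \<in> braid_words n" using Cons.prems by auto
    let ?E = "word_eval (GL n) (burau_gen n) w"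
    have E: "?E \<in> carrier_mat n n" by (intro Gamma_carrier word_eval_burau_Gamma w)
    have "burau_gen n i * ?E * A = burau_gen n i * (?E * A)"
      "burau_gen_inv n i * ?E * A = burau_gen_inv n i * (?E * A)"
      using assoc_mult_mat[OF burau_gen_carrier[OF i] E assms(2)]
        assoc_mult_mat[OF burau_gen_inv_carrier E assms(2)] by auto
    moreover have "?E * A \<in> carrier_mat n n" using E assms(2) by simp
    ultimately show ?case
      using x odd_monomial_gen[OF i _ Cons.IH[OF w]] by (simp add: GL_simps(2) inv_burau_gen[OF i])
  qed
  with w show ?thesis by simp
qed

section \<open>Moving the last column to the last unit vector\<close>

text \<open>After the sign change this alternating list is constantly -1, that is,
  \<open>e_n - v_n\<close> without its last entry 0.\<close>

lemma blocks_replicate: "blocks (replicate k (- 1)) = map (\<lambda>i. (- 1) ^ Suc i) [0..<2 * k]"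
proof (induction k)
  case (Suc k)
  have "blocks (replicate (Suc k) (- 1)) = blocks (replicate k (- 1)) @ [- 1, 1]"
    unfolding replicate_Suc replicate_append_same[symmetric] by simp
  also have "\<dots> = map (\<lambda>i. (- 1) ^ Suc i) [0..<2 * Suc k]"
    unfolding Suc.IH by simp
  finally show ?case .
qed simp

lemma length_filter_map_upt: "length (filter P (map f [0..<n])) = card {i. i < n \<and> P (f i)}"
  by (simp add: length_filter_conv_card cong: conj_cong)

lemma sum_list_map_upt: "sum_list (map f [0..<n]) = (\<Sum>i<n. f i :: int)"
  by (simp add: sum_list_sum_nth atLeast0LessThan)

lemma move_last_column:
  assumes n: "n \<ge> 1" and A: "A \<in> Gamma (Suc n)" and odd: "odd_monomial (Suc n) A"
  shows "\<exists>M\<in>burau_image (Suc n). M *\<^sub>v col A n = unit_vec (Suc n) n"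
proof -
  have Ac: "A \<in> carrier_mat (Suc n) (Suc n)" by (rule Gamma_carrier[OF A])
  have w: "(\<Sum>i<Suc n. (- 1) ^ i * A $$ (i, n)) = (- 1) ^ n" by (rule Gamma_entries[OF A]) simp
  have "\<exists>!r. r < Suc n \<and> odd (A $$ (r, n))" using odd by (simp add: odd_monomial_def)
  then obtain r where r: "{r. r < Suc n \<and> odd (A $$ (r, n))} = {r}" "r < Suc n" by blast
  have cc: "col A n \<in> carrier_vec (Suc n)" by (rule carrier_vecI) (use Ac in simp)
  show ?thesis
  \<comment> \<open>The length is \<open>Suc n\<close>, so odd \<open>n\<close> belongs to the
    reduction for even length.\<close>
  proof (cases "even n")
    case False
    \<comment> \<open>The alternating sum of the column is -1 here; the extra sign makes it
      1.\<close>
    define xs where "xs = map (\<lambda>i. - ((- 1) ^ i * A $$ (i, n))) [0..<Suc n]"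
    have len: "length xs = Suc n" by (simp add: xs_def)
    have "sum_list xs = 1" unfolding xs_def sum_list_map_upt sum_negf w using False by simp
    moreover have "length (filter odd xs) = 1"
      unfolding xs_def length_filter_map_upt using r(1) by simp
    ultimately have "xs \<approx> replicate n 0 @ [1]"
      using burau_equiv_even_length[of xs] False len by simp
    then obtain M where M: "M \<in> burau_image (Suc n)" "M *\<^sub>v alt_vec xs = alt_vec (replicate n 0 @ [1])"
      using burau_equiv_image len by metis
    have "alt_vec xs = - col A n"
      using Ac by (intro eq_vecI) (auto simp: alt_vec_def xs_def simp del: upt_Suc)
    then have "M *\<^sub>v (- col A n) = alt_vec (replicate n 0 @ [1])" using M(2) by simp
    also have "\<dots> = - unit_vec (Suc n) n"
      using False by (intro eq_vecI) (auto simp: alt_vec_def nth_append unit_vec_def)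
    finally have eq: "M *\<^sub>v (- col A n) = - unit_vec (Suc n) n" .
    have Mc: "M \<in> carrier_mat (Suc n) (Suc n)" by (rule burau_image_carrier[OF M(1)])
    have "M *\<^sub>v col A n = unit_vec (Suc n) n"
    proof (rule eq_vecI)
      fix i assume "i < dim_vec (unit_vec (Suc n) n :: int vec)"
      then show "(M *\<^sub>v col A n) $ i = unit_vec (Suc n) n $ i"
        using arg_cong[OF eq, of "\<lambda>x. x $ i"] Mc Ac by simp
    qed (use Mc in simp)
    then show ?thesis using M(1) by blast
  next
    case True
    \<comment> \<open>The whole image fixes \<open>v_vec (Suc n)\<close>, so it suffices to move the
      difference. Both vectors have alternating sum 1.\<close>
    define xs where "xs = map (\<lambda>i. (- 1) ^ i * (A $$ (i, n) - 1)) [0..<Suc n]"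
    have len: "length xs = Suc n" by (simp add: xs_def)
    have alt: "alt_vec xs = col A n - v_vec (Suc n)"
      using Ac by (intro eq_vecI) (auto simp: alt_vec_def xs_def v_vec_def simp del: upt_Suc)
    have vc: "v_vec (Suc n) \<in> carrier_vec (Suc n)" by (simp add: v_vec_def)
    have "(\<Sum>i<Suc m. (- 1) ^ i :: int) = (if even m then 1 else 0)" for m
      by (induction m) auto
    then have "(\<Sum>i<Suc n. (- 1) ^ i :: int) = 1" using True by metis
    then have "sum_list xs = 0" unfolding xs_def sum_list_map_upt
      using w True by (simp add: right_diff_distrib sum_subtractf del: sum.lessThan_Suc)
    moreover have "length (filter odd xs) = n"
    proof -
      have "{i. i < Suc n \<and> odd ((- 1) ^ i * (A $$ (i, n) - 1))} = {..<Suc n} - {r}"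
        using r by auto
      then show ?thesis unfolding xs_def length_filter_map_upt using r(2) by simp
    qed
    \<comment> \<open>The inverse of \<open>A\<close> sends the difference to
      \<open>unit_vec (Suc n) n - v_vec (Suc n)\<close>, whose entry 0 is -1 because
      \<open>n \<ge> 1\<close>; a common divisor of the entries divides it.\<close>
    moreover have "d dvd 1" if d: "\<forall>x\<in>set xs. d dvd x" for d
    proof -
      obtain B where B: "B \<in> Gamma (Suc n)" "B * A = 1\<^sub>m (Suc n)" by (rule Gamma_inverse[OF A])
      have Bc: "B \<in> carrier_mat (Suc n) (Suc n)" by (rule Gamma_carrier[OF B(1)])
      have "B *\<^sub>v (col A n - v_vec (Suc n)) = B *\<^sub>v col A n - B *\<^sub>v v_vec (Suc n)"
        by (rule mult_minus_distrib_mat_vec[OF Bc cc vc])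
      also have "B *\<^sub>v col A n = unit_vec (Suc n) n"
        using col_mult2[OF Bc Ac, of n] B(2) by simp
      also have "B *\<^sub>v v_vec (Suc n) = v_vec (Suc n)" using B(1) by (simp add: Gamma_def)
      finally have "(B *\<^sub>v (col A n - v_vec (Suc n))) $ 0 = - 1" using n by (simp add: v_vec_def)
      moreover have "d dvd (B *\<^sub>v (col A n - v_vec (Suc n))) $ 0"
      proof -
        have "d dvd A $$ (i, n) - 1" if "i < Suc n" for i
        proof -
          have "(- 1) ^ i * (A $$ (i, n) - 1) \<in> set xs"
            using that by (auto simp: xs_def simp del: upt_Suc)
          then have "d dvd (- 1) ^ i * (A $$ (i, n) - 1)" using d by blast
          then show ?thesis by (simp add: dvd_mult_unit_iff' minus_one_power_iff split: if_splits)
        qed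
        then show ?thesis using Bc Ac vc
          by (auto simp: scalar_prod_def v_vec_def intro!: dvd_add dvd_sum dvd_mult)
      qed
      ultimately show ?thesis by simp
    qed
    ultimately have "xs \<approx> blocks (replicate (Suc n div 2) (- 1)) @ [0]"
      using burau_equiv_odd_length[of xs] True len by simp
    then obtain M where M: "M \<in> burau_image (Suc n)"
        "M *\<^sub>v alt_vec xs = alt_vec (blocks (replicate (Suc n div 2) (- 1)) @ [0])"
      using burau_equiv_image len by metis
    have Mc: "M \<in> carrier_mat (Suc n) (Suc n)" by (rule burau_image_carrier[OF M(1)])
    have "M *\<^sub>v col A n - v_vec (Suc n) = M *\<^sub>v col A n - M *\<^sub>v v_vec (Suc n)"
      using burau_image_Gamma[OF M(1)] by (simp add: Gamma_def)
    also have "\<dots> = M *\<^sub>v alt_vec xs"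
      unfolding alt by (rule mult_minus_distrib_mat_vec[OF Mc cc vc, symmetric])
    also have "\<dots> = unit_vec (Suc n) n - v_vec (Suc n)"
      unfolding M(2) using True
      by (intro eq_vecI) (auto simp: alt_vec_def blocks_replicate nth_append v_vec_def
          less_Suc_eq power_add[symmetric] simp del: upt_Suc)
    finally have eq: "M *\<^sub>v col A n - v_vec (Suc n) = unit_vec (Suc n) n - v_vec (Suc n)" .
    have "M *\<^sub>v col A n = unit_vec (Suc n) n"
    proof (rule eq_vecI)
      fix i assume "i < dim_vec (unit_vec (Suc n) n :: int vec)"
      then show "(M *\<^sub>v col A n) $ i = unit_vec (Suc n) n $ i"
        using arg_cong[OF eq, of "\<lambda>x. x $ i"] Mc by (simp add: v_vec_def)
    qed (use Mc in simp)
    then show ?thesis using M(1) by blast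
  qed
qed

section \<open>The stabilizer of the last basis vector\<close>

definition extend_mat :: "nat \<Rightarrow> int mat \<Rightarrow> int mat" where
  "extend_mat n A = mat (Suc n) (Suc n)
    (\<lambda>(i, j). if i < n \<and> j < n then A $$ (i, j) else if i = j then 1 else 0)"

lemma extend_mat_carrier: "extend_mat n A \<in> carrier_mat (Suc n) (Suc n)"
  by (simp add: extend_mat_def)

lemma extend_mat_one: "extend_mat n (1\<^sub>m n) = 1\<^sub>m (Suc n)"
  by (intro eq_matI) (auto simp: extend_mat_def)

lemma extend_mat_mult:
  assumes "A \<in> carrier_mat n n" "B \<in> carrier_mat n n"
  shows "extend_mat n (A * B) = extend_mat n A * extend_mat n B"
  using assms
  by (intro eq_matI) (auto simp: extend_mat_def scalar_prod_def less_Suc_eq intro!: sum.neutral)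

lemma extend_mat_inject:
  assumes "A \<in> carrier_mat n n" "B \<in> carrier_mat n n" "extend_mat n A = extend_mat n B"
  shows "A = B"
proof (rule eq_matI)
  fix i j assume "i < dim_row B" "j < dim_col B"
  then show "A $$ (i, j) = B $$ (i, j)"
    using assms(2) arg_cong[OF assms(3), of "\<lambda>A. A $$ (i, j)"] by (simp add: extend_mat_def)
qed (use assms in auto)

lemma extend_mat_gen:
  assumes "1 \<le> i" "i < n"
  shows "extend_mat n (burau_gen n i) = burau_gen (Suc n) i"
    "extend_mat n (burau_gen_inv n i) = burau_gen_inv (Suc n) i"
proof -
  show "extend_mat n (burau_gen n i) = burau_gen (Suc n) i"
    using assms burau_gen_carrier[of i "Suc n"]
    by (intro eq_matI) (auto simp: extend_mat_def burau_gen_index)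
  show "extend_mat n (burau_gen_inv n i) = burau_gen_inv (Suc n) i"
    using assms by (intro eq_matI) (auto simp: extend_mat_def burau_gen_inv_def)
qed

lemma extend_mat_image:
  assumes "A \<in> burau_image n"
  shows "extend_mat n A \<in> burau_image (Suc n)"
proof -
  obtain w where w: "w \<in> braid_words n" "A = word_eval (GL n) (burau_gen n) w"
    using assms by (auto simp: burau_image_words)
  have "extend_mat n (word_eval (GL n) (burau_gen n) w) = word_eval (GL (Suc n)) (burau_gen (Suc n)) w"
    using w(1)
  proof (induction w)
    case Nil
    then show ?case by (simp add: GL_simps(3) extend_mat_one)
  next
    case (Cons x w)
    obtain i b where x: "x = (i, b)" by (cases x)
    then have i: "1 \<le> i" "i < n" and w: "w \<in> braid_words n" using Cons.prems by auto
    have "word_eval (GL n) (burau_gen n) w \<in> carrier_mat n n"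
      by (intro Gamma_carrier word_eval_burau_Gamma w)
    then show ?case
      using Cons.IH[OF w] i x burau_gen_carrier[OF i] burau_gen_inv_carrier[of n i]
      by (simp add: GL_simps(2) inv_burau_gen extend_mat_mult extend_mat_gen)
  qed
  moreover have "w \<in> braid_words (Suc n)" using w(1) by (auto simp: braid_words_def)
  ultimately show ?thesis using w(2) unfolding burau_image_words by auto
qed

lemma alt_form_unit_last:
  assumes "x \<in> carrier_vec (Suc n)"
  shows "alt_form (Suc n) x (unit_vec (Suc n) n) = (\<Sum>i<n. x $ i * (- 1) ^ (i + n + 1))"
proof -
  have "(\<Sum>j<Suc n. x $ i * unit_vec (Suc n) n $ j * form_basis i j) = x $ i * form_basis i n" for i
    by (simp add: sum.neutral)
  then have "alt_form (Suc n) x (unit_vec (Suc n) n) = (\<Sum>i<Suc n. x $ i * form_basis i n)"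
    unfolding alt_form_def by (simp del: sum.lessThan_Suc)
  then show ?thesis by (simp add: form_basis_def)
qed

lemma mult_unit_vec:
  "A \<in> carrier_mat m n \<Longrightarrow> j < n \<Longrightarrow> A *\<^sub>v unit_vec n j = col (A :: int mat) j"
  by (intro eq_vecI) auto

text \<open>Invariance of the pairing with the last basis vector gives the alternating sum of the
  first \<open>n\<close> entries of column \<open>c\<close>; \<open>w_vec\<close> gives the same
  value for all \<open>Suc n\<close> entries. Hence the last one is 0.\<close>

lemma Gamma_fix_last:
  assumes B: "B \<in> Gamma (Suc n)" and fix_last: "col B n = unit_vec (Suc n) n"
  shows "\<exists>A. A \<in> carrier_mat n n \<and> B = extend_mat n A"
proof -
  have Bc: "B \<in> carrier_mat (Suc n) (Suc n)" by (rule Gamma_carrier[OF B])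
  have last: "B $$ (i, n) = (if i = n then 1 else 0)" if "i < Suc n" for i
    using arg_cong[OF fix_last, of "\<lambda>x. x $ i"] that Bc by simp
  have unit: "B *\<^sub>v unit_vec (Suc n) c = col B c" if "c < Suc n" for c
    using Bc that by (simp add: mult_unit_vec)
  have "B $$ (n, c) = 0" if c: "c < n" for c
  proof -
    have "alt_form (Suc n) (col B c) (unit_vec (Suc n) n) =
        alt_form (Suc n) (B *\<^sub>v unit_vec (Suc n) c) (B *\<^sub>v unit_vec (Suc n) n)"
      using unit[of c] unit[of n] fix_last c by simp
    also have "\<dots> = alt_form (Suc n) (unit_vec (Suc n) c) (unit_vec (Suc n) n)"
      using B by (simp add: Gamma_def)
    finally have "(\<Sum>i<n. B $$ (i, c) * (- 1) ^ (i + n + 1)) =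
        (\<Sum>i<n. (unit_vec (Suc n) c :: int vec) $ i * (- 1) ^ (i + n + 1))"
      using Bc c alt_form_unit_last[of "col B c"] by (simp add: alt_form_unit_last carrier_vecI)
    also have "\<dots> = (- 1) ^ (c + n + 1)"
      using c by (subst sum.remove[of _ c]) (auto intro!: sum.neutral)
    also have "(\<Sum>i<n. B $$ (i, c) * (- 1) ^ (i + n + 1)) =
        (\<Sum>i<n. (- 1) ^ i * B $$ (i, c)) * (- 1) ^ (n + 1)"
      unfolding sum_distrib_right by (intro sum.cong) (auto simp: power_add)
    also have "(- 1) ^ (c + n + 1) = (- 1) ^ c * (- 1 :: int) ^ (n + 1)" by (simp add: power_add)
    finally have "(\<Sum>i<n. (- 1) ^ i * B $$ (i, c)) = (- 1) ^ c" by simp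
    then show ?thesis using Gamma_entries(2)[OF B, of c] c by simp
  qed
  then have "B = extend_mat n (mat n n (\<lambda>(i, j). B $$ (i, j)))"
    using Bc last by (intro eq_matI) (auto simp: extend_mat_def less_Suc_eq)
  then show ?thesis by (metis mat_carrier)
qed

text \<open>The inverse also fixes the last basis vector, so it has block form and supplies an
  inverse of \<open>A\<close>. The form restricts because \<open>form_basis\<close> does not depend
  on the dimension.\<close>

lemma Gamma_extend_mat:
  assumes A: "A \<in> carrier_mat n n" and E: "extend_mat n A \<in> Gamma (Suc n)"
  shows "A \<in> Gamma n"
proof -
  obtain B' where B': "B' \<in> Gamma (Suc n)" "B' * extend_mat n A = 1\<^sub>m (Suc n)"
      "extend_mat n A * B' = 1\<^sub>m (Suc n)"
    by (rule Gamma_inverse[OF E])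
  have colE: "col (extend_mat n A) n = unit_vec (Suc n) n"
    by (intro eq_vecI) (auto simp: extend_mat_def)
  have "col B' n = B' *\<^sub>v col (extend_mat n A) n"
    using Gamma_carrier[OF B'(1)] unfolding colE by (simp add: mult_unit_vec)
  also have "\<dots> = unit_vec (Suc n) n"
    using col_mult2[OF Gamma_carrier[OF B'(1)] extend_mat_carrier, of n A] B'(2) by simp
  finally obtain B where B: "B \<in> carrier_mat n n" "B' = extend_mat n B"
    using Gamma_fix_last[OF B'(1)] by blast
  have "extend_mat n (B * A) = extend_mat n (1\<^sub>m n)" "extend_mat n (A * B) = extend_mat n (1\<^sub>m n)"
    using B'(2,3) unfolding B(2) extend_mat_mult[OF B(1) A] extend_mat_mult[OF A B(1)] extend_mat_one
    by simp_all
  then have "B * A = 1\<^sub>m n" "A * B = 1\<^sub>m n"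
    using A B(1) extend_mat_inject[of "B * A" n "1\<^sub>m n"] extend_mat_inject[of "A * B" n "1\<^sub>m n"]
    by auto
  then have GL: "A \<in> carrier (GL n)" using A B by (auto simp: GL_simps)
  define e :: "int vec \<Rightarrow> int vec" where "e x = vec (Suc n) (\<lambda>i. if i < n then x $ i else 0)" for x
  have ec: "e x \<in> carrier_vec (Suc n)" for x by (simp add: e_def)
  have e_mult: "extend_mat n A *\<^sub>v e x = e (A *\<^sub>v x)" if "x \<in> carrier_vec n" for x
    using that A by (intro eq_vecI)
      (auto simp: e_def extend_mat_def scalar_prod_def less_Suc_eq intro!: sum.neutral)
  have e_form: "alt_form (Suc n) (e x) (e y) = alt_form n x y" for x y
    by (simp add: alt_form_def e_def)
  have "alt_form n (A *\<^sub>v x) (A *\<^sub>v y) = alt_form n x y"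
    if "x \<in> carrier_vec n" "y \<in> carrier_vec n" for x y
  proof -
    have "alt_form (Suc n) (extend_mat n A *\<^sub>v e x) (extend_mat n A *\<^sub>v e y) = alt_form (Suc n) (e x) (e y)"
      using E ec by (simp add: Gamma_def)
    then show ?thesis by (simp add: e_mult e_form that)
  qed
  moreover have "(\<Sum>j<n. A $$ (i, j)) = 1" if "i < n" for i
    using Gamma_entries(1)[OF E, of i] that by (simp add: extend_mat_def)
  then have "A *\<^sub>v v_vec n = v_vec n"
    using A by (intro eq_vecI) (auto simp: v_vec_def scalar_prod_def atLeast0LessThan)
  moreover have "(\<Sum>i<n. (- 1) ^ i * A $$ (i, j)) = (- 1) ^ j" if "j < n" for j
    using Gamma_entries(2)[OF E, of j] that by (simp add: extend_mat_def)
  then have "mat_of_row (w_vec n) * A = mat_of_row (w_vec n)"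
    using A by (intro eq_matI) (auto simp: w_vec_def mat_of_row_def scalar_prod_def atLeast0LessThan)
  ultimately show ?thesis using GL by (simp add: Gamma_def)
qed

section \<open>Induction on the number of strands\<close>

lemma odd_monomial_in_image:
  assumes "n \<ge> 1" "A \<in> Gamma n" "odd_monomial n A"
  shows "A \<in> burau_image n"
  using assms
proof (induction n arbitrary: A rule: nat_induct_at_least)
  case base
  \<comment> \<open>For size 1 the row sum forces the only entry to be 1.\<close>
  have "A = 1\<^sub>m 1"
    using Gamma_carrier[OF base(1)] Gamma_entries(1)[OF base(1), of 0] by (intro eq_matI) auto
  then show ?case using burau_image_one[of 1] by simp
next
  case (Suc n)
  have Ac: "A \<in> carrier_mat (Suc n) (Suc n)" by (rule Gamma_carrier[OF Suc.prems(1)])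
  obtain M where M: "M \<in> burau_image (Suc n)" "M *\<^sub>v col A n = unit_vec (Suc n) n"
    using move_last_column[OF Suc.hyps Suc.prems] by blast
  have MA: "M * A \<in> Gamma (Suc n)"
    using subgroup.m_closed[OF subgroup_Gamma burau_image_Gamma[OF M(1)] Suc.prems(1)]
    by (simp add: GL_simps(2))
  have "col (M * A) n = unit_vec (Suc n) n"
    using col_mult2[OF burau_image_carrier[OF M(1)] Ac, of n] M(2) by simp
  then obtain A' where A': "A' \<in> carrier_mat n n" "M * A = extend_mat n A'"
    using Gamma_fix_last[OF MA] by blast
  have odd: "odd_monomial (Suc n) (extend_mat n A')"
    using odd_monomial_image[OF M(1) Ac Suc.prems(2)] A'(2) by simp
  have "odd_monomial n A'"
    unfolding odd_monomial_def
  proof (intro allI impI)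
    fix c assume c: "c < n"
    \<comment> \<open>The last row of the extension vanishes in column \<open>c\<close>, so the odd
      entry lies in \<open>A'\<close>.\<close>
    have "r < Suc n \<and> odd (extend_mat n A' $$ (r, c)) \<longleftrightarrow> r < n \<and> odd (A' $$ (r, c))" for r
      using c by (auto simp: extend_mat_def less_Suc_eq)
    then show "\<exists>!r. r < n \<and> odd (A' $$ (r, c))"
      using odd c unfolding odd_monomial_def by (metis less_Suc_eq)
  qed
  then have "A' \<in> burau_image n"
    using Gamma_extend_mat[OF A'(1)] MA A'(2) by (intro Suc.IH) auto
  then have "M * A \<in> burau_image (Suc n)" using extend_mat_image A'(2) by simp
  then show ?case by (rule burau_image_cancel[OF M(1) _ Ac])
qed

lemma odd_monomial_cong_even:
  assumes "A \<in> Gamma_cong n l" "even l"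
  shows "odd_monomial n A"
  unfolding odd_monomial_def
proof (intro allI impI)
  fix c assume c: "c < n"
  have A: "A \<in> carrier_mat n n" "mat_cong l A (1\<^sub>m n)"
    using assms(1) by (auto simp: Gamma_cong_def Gamma_carrier)
  have "odd (A $$ (r, c)) \<longleftrightarrow> r = c" if "r < n" for r
  proof -
    have "int l dvd A $$ (r, c) - 1\<^sub>m n $$ (r, c)" using A that c by (auto simp: mat_cong_def)
    moreover have "2 dvd int l" using assms(2) by simp
    ultimately have "even (A $$ (r, c) - 1\<^sub>m n $$ (r, c))" by (rule dvd_trans[rotated])
    then show ?thesis using that c by (auto split: if_splits)
  qed
  then show "\<exists>!r. r < n \<and> odd (A $$ (r, c))" using c by blast
qed

text \<open>On three strands the only other possibility is a column with three odd entries; but then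
  \<open>A (e\<^sub>c - v)\<close> would vanish modulo \<open>2\<close>.\<close>

lemma odd_monomial_small:
  assumes n: "n \<in> {2, 3}" and A: "A \<in> Gamma n"
  shows "odd_monomial n A"
  unfolding odd_monomial_def
proof (intro allI impI)
  fix c assume c: "c < n"
  have Ac: "A \<in> carrier_mat n n" by (rule Gamma_carrier[OF A])
  have w: "(\<Sum>i<n. (- 1) ^ i * A $$ (i, c)) = (- 1) ^ c" by (rule Gamma_entries(2)[OF A c])
  have not_all: "\<exists>r<n. even (A $$ (r, c))"
  proof (rule ccontr)
    assume "\<not> ?thesis"
    then have all: "even (A $$ (r, c) - 1)" if "r < n" for r using that by simp
    obtain B where B: "B \<in> Gamma n" "B * A = 1\<^sub>m n" by (rule Gamma_inverse[OF A])
    have Bc: "B \<in> carrier_mat n n" by (rule Gamma_carrier[OF B(1)])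
    have vc: "v_vec n \<in> carrier_vec n" by (simp add: v_vec_def)
    have cc: "col A c \<in> carrier_vec n" by (rule carrier_vecI) (use Ac in simp)
    have "B *\<^sub>v (col A c - v_vec n) = B *\<^sub>v col A c - B *\<^sub>v v_vec n"
      by (rule mult_minus_distrib_mat_vec[OF Bc cc vc])
    also have "B *\<^sub>v col A c = unit_vec n c" using col_mult2[OF Bc Ac c] B(2) c by simp
    also have "B *\<^sub>v v_vec n = v_vec n" using B(1) by (simp add: Gamma_def)
    finally have eq: "B *\<^sub>v (col A c - v_vec n) = unit_vec n c - v_vec n" .
    obtain r where r: "r < n" "r \<noteq> c" using n c
      by (metis One_nat_def insertE less_Suc_eq numeral_2_eq_2 numeral_3_eq_3 singletonD zero_less_Suc zero_neq_one)
    have "even ((B *\<^sub>v (col A c - v_vec n)) $ r)"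
      using Bc Ac vc r(1) all c by (auto simp: scalar_prod_def v_vec_def intro!: dvd_sum dvd_mult)
    then show False unfolding eq using r c by (simp add: v_vec_def)
  qed
  \<comment> \<open>The signed column sum is odd, so the number of odd entries is odd; with at most
    three rows, one of them even, it is 1.\<close>
  have "odd ((- 1 :: int) ^ c)" by simp
  then have "odd (\<Sum>i<n. (- 1) ^ i * A $$ (i, c))" unfolding w .
  with n not_all show "\<exists>!r. r < n \<and> odd (A $$ (r, c))"
    by (auto simp: eval_nat_numeral less_Suc_eq)
qed

section \<open>Congruence subgroups and the symmetric group\<close>

lemma burau_braid_cong: "burau n ` braid_cong n l = Gamma_cong n l \<inter> burau_image n"
  unfolding braid_cong_def Gamma_cong_def burau_image_def using burau_Gamma by auto

lemma one_braid_cong: "\<one>\<^bsub>braid_group n\<^esub> \<in> braid_cong n l" "braid_perm n \<one>\<^bsub>braid_group n\<^esub> = id"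
  by (auto simp: braid_cong_def one_braid_group carrier_braid_group burau_class braid_perm_class
      GL_simps(3) sym_group_one)

lemma mult_braid_cong:
  assumes "a \<in> braid_cong n l" "b \<in> braid_cong n l"
  shows "a \<otimes>\<^bsub>braid_group n\<^esub> b \<in> braid_cong n l"
    "braid_perm n (a \<otimes>\<^bsub>braid_group n\<^esub> b) = braid_perm n a \<circ> braid_perm n b"
proof -
  have ab: "a \<in> carrier (braid_group n)" "b \<in> carrier (braid_group n)"
    "mat_cong l (burau n a) (1\<^sub>m n)" "mat_cong l (burau n b) (1\<^sub>m n)"
    using assms by (auto simp: braid_cong_def)
  have "mat_cong l (burau n a * burau n b) (1\<^sub>m n * 1\<^sub>m n)"
    using ab Gamma_carrier[OF burau_Gamma[OF ab(1)]] Gamma_carrier[OF burau_Gamma[OF ab(2)]]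
    by (intro mat_cong_mult)
  then show "a \<otimes>\<^bsub>braid_group n\<^esub> b \<in> braid_cong n l"
    using ab hom_mult[OF burau_hom ab(1,2)] group.is_monoid[OF braid_group_is_group]
    by (simp add: braid_cong_def GL_simps(2) monoid.m_closed)
  show "braid_perm n (a \<otimes>\<^bsub>braid_group n\<^esub> b) = braid_perm n a \<circ> braid_perm n b"
    using hom_mult[OF braid_perm_hom ab(1,2)] by (simp add: sym_group_mult)
qed

section \<open>Permutations induced by braids of odd level\<close>

text \<open>The generator is \<open>I + N\<close> with \<open>N * N = 0\<close>, so its powers are
  \<open>I + k * N\<close>.\<close>

lemma burau_gen_power_index:
  assumes "1 \<le> i" "i < n" "r < n" "c < n"
  shows "word_eval (GL n) (burau_gen n) (replicate k (i, True)) $$ (r, c) =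
    (if r = c then 1 else 0) +
      int k * (if r = i - 1 \<or> r = i then (if c = i - 1 then 1 else if c = i then - 1 else 0) else 0)"
  using assms(3)
proof (induction k arbitrary: r)
  case 0
  then show ?case using assms by (simp add: GL_simps(3))
next
  case (Suc k)
  have "replicate k (i, True) \<in> braid_words n" using assms by (auto simp: braid_words_def)
  then have E: "word_eval (GL n) (burau_gen n) (replicate k (i, True)) \<in> carrier_mat n n"
    by (intro Gamma_carrier word_eval_burau_Gamma)
  then show ?case using Suc assms(1,2,4)
    by (auto simp del: index_mult_mat(1) simp: GL_simps(2) burau_gen_mult_index algebra_simps)
qed

lemma sym_gen_power:
  "word_eval (sym_group n) (\<lambda>i. transpose i (i + 1)) (replicate k (i, True)) =
    (if odd k then transpose i (i + 1) else id)"
  by (induction k) (auto simp: sym_group_one sym_group_mult)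

text \<open>Conjugating the transposition of \<open>a\<close> and \<open>b\<close> by that of
  \<open>b\<close> and \<open>b + 1\<close> gives the one of \<open>a\<close> and
  \<open>b + 1\<close>, so adjacent transpositions generate all.\<close>

lemma permutes_adjacent_induct:
  fixes n :: nat and S :: "(nat \<Rightarrow> nat) set"
  assumes "p permutes {1..n}" and id: "id \<in> S"
    and comp: "\<And>f g. f \<in> S \<Longrightarrow> g \<in> S \<Longrightarrow> f \<circ> g \<in> S"
    and adj: "\<And>i. 1 \<le> i \<Longrightarrow> i < n \<Longrightarrow> transpose i (i + 1) \<in> S"
  shows "p \<in> S"
proof -
  have shift: "transpose a (a + Suc d) \<in> S" if "1 \<le> a" "a + Suc d \<le> n" for a d
    using that(2)
  proof (induction d)
    case 0
    then show ?case using adj[of a] that(1) by simp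
  next
    case (Suc d)
    let ?b = "a + Suc d"
    have eq: "transpose a (a + Suc (Suc d)) =
        transpose ?b (?b + 1) \<circ> (transpose a ?b \<circ> transpose ?b (?b + 1))"
      by (auto simp: fun_eq_iff transpose_def)
    have "transpose ?b (?b + 1) \<in> S" "transpose a ?b \<in> S"
      using Suc adj[of ?b] that(1) by simp_all
    then show ?case unfolding eq by (intro comp)
  qed
  have less: "transpose a b \<in> S" if "1 \<le> a" "a < b" "b \<le> n" for a b
    using shift[of a "b - a - 1"] that by simp
  have trans: "transpose a b \<in> S" if "a \<in> {1..n}" "b \<in> {1..n}" "a \<noteq> b" for a b
  proof (cases "a < b")
    case True
    then show ?thesis using less that by simp
  next
    case False
    then have "transpose b a \<in> S" using less that by simp
    then show ?thesis by (simp add: transpose_commute)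
  qed
  show ?thesis
    using assms(1) finite_atLeastAtMost[of 1 n]
  proof (induction rule: permutes_induct)
    case (swap a b p)
    then show ?case by (intro comp trans)
  qed (rule id)
qed

text \<open>For odd \<open>l\<close> the \<open>l\<close>-th power of a generator has level
  \<open>l\<close> and still induces the adjacent transposition.\<close>

lemma braid_cong_perm_surj:
  assumes l: "odd l" and p: "p \<in> carrier (sym_group n)"
  obtains b where "b \<in> braid_cong n l" "braid_perm n b = p"
proof -
  have "p permutes {1..n}" using p by (simp add: sym_group_def)
  then have "p \<in> braid_perm n ` braid_cong n l"
  proof (rule permutes_adjacent_induct)
    show "id \<in> braid_perm n ` braid_cong n l"
      by (rule image_eqI[OF _ one_braid_cong(1)]) (simp add: one_braid_cong(2))
    show "f \<circ> g \<in> braid_perm n ` braid_cong n l"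
      if "f \<in> braid_perm n ` braid_cong n l" "g \<in> braid_perm n ` braid_cong n l" for f g
      using that by (auto simp: mult_braid_cong(2)[symmetric] intro: mult_braid_cong(1))
    fix i assume i: "1 \<le> i" "i < n"
    let ?w = "replicate l (i, True)"
    have w: "?w \<in> braid_words n" using i by (auto simp: braid_words_def)
    have "word_eval (GL n) (burau_gen n) ?w \<in> carrier_mat n n"
      by (intro Gamma_carrier word_eval_burau_Gamma w)
    then have "mat_cong l (word_eval (GL n) (burau_gen n) ?w) (1\<^sub>m n)"
      by (auto simp: mat_cong_def burau_gen_power_index[OF i])
    then have "braid_class n ?w \<in> braid_cong n l"
      using w by (auto simp: braid_cong_def carrier_braid_group burau_class)
    moreover have "braid_perm n (braid_class n ?w) = transpose i (i + 1)"
      unfolding braid_perm_class[OF w] sym_gen_power using l by simp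
    ultimately show "transpose i (i + 1) \<in> braid_perm n ` braid_cong n l" by (metis imageI)
  qed
  then show ?thesis using that by blast
qed

section \<open>The quotient of level \<open>2 * l\<close> and the symmetric group in it\<close>

lemma Gamma_cong_GL: "A \<in> Gamma_cong n l \<Longrightarrow> A \<in> carrier (GL n)"
  by (simp add: Gamma_cong_def Gamma_def)

lemma Gamma_cong_mono: "k dvd l \<Longrightarrow> Gamma_cong n l \<subseteq> Gamma_cong n k"
  by (auto simp: Gamma_cong_def mat_cong_def intro: dvd_trans[of "int k" "int l"])

lemma carrier_Gamma_quot:
  "carrier (Gamma_quot n l) = (\<lambda>A. Gamma_cong n (2 * l) #>\<^bsub>GL n\<^esub> A) ` Gamma_cong n l"
  by (simp add: Gamma_quot_def carrier_FactGroup r_coset_def)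

text \<open>A coset of level \<open>2 * l\<close> lies inside one coset of level 2, so
  \<open>the_elem\<close> is applied to a singleton.\<close>

lemma quot_map_coset:
  assumes A: "A \<in> Gamma_cong n l"
  shows "quot_map n (Gamma_cong n (2 * l) #>\<^bsub>GL n\<^esub> A) = Gamma_cong n 2 #>\<^bsub>GL n\<^esub> A"
proof -
  have "Gamma_cong n 2 #>\<^bsub>GL n\<^esub> X = Gamma_cong n 2 #>\<^bsub>GL n\<^esub> A"
    if "X \<in> Gamma_cong n (2 * l) #>\<^bsub>GL n\<^esub> A" for X
  proof -
    have "X \<in> Gamma_cong n 2 #>\<^bsub>GL n\<^esub> A"
      using that Gamma_cong_mono[of 2 "2 * l" n] by (auto simp: r_coset_def)
    then show ?thesis
      by (rule group.repr_independence[OF GL_group _ Gamma_cong_GL[OF A] subgroup_Gamma_cong, symmetric])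
  qed
  moreover have "A \<in> Gamma_cong n (2 * l) #>\<^bsub>GL n\<^esub> A"
    by (rule group.rcos_self[OF GL_group Gamma_cong_GL[OF A] subgroup_Gamma_cong])
  ultimately have "(\<lambda>X. Gamma_cong n 2 #>\<^bsub>GL n\<^esub> X) ` (Gamma_cong n (2 * l) #>\<^bsub>GL n\<^esub> A) =
      {Gamma_cong n 2 #>\<^bsub>GL n\<^esub> A}" by blast
  then show ?thesis by (simp add: quot_map_def)
qed

lemma Gamma_cong_Int: "odd l \<Longrightarrow> Gamma_cong n 2 \<inter> Gamma_cong n l \<subseteq> Gamma_cong n (2 * l)"
  by (auto simp: Gamma_cong_def mat_cong_def intro!: divides_mult)

text \<open>If the images agree, the quotient of two representatives has level 2 and level
  \<open>l\<close>, hence level \<open>2 * l\<close> as these are coprime.\<close>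

lemma inj_on_quot_map:
  assumes l: "odd l"
  shows "inj_on (quot_map n) (carrier (Gamma_quot n l))"
proof (rule inj_onI)
  fix X Y assume "X \<in> carrier (Gamma_quot n l)" "Y \<in> carrier (Gamma_quot n l)"
    and eq: "quot_map n X = quot_map n Y"
  then obtain A B where A: "A \<in> Gamma_cong n l" "X = Gamma_cong n (2 * l) #>\<^bsub>GL n\<^esub> A"
    and B: "B \<in> Gamma_cong n l" "Y = Gamma_cong n (2 * l) #>\<^bsub>GL n\<^esub> B"
    by (auto simp: carrier_Gamma_quot)
  interpret group "GL n" by (rule GL_group)
  note AG = Gamma_cong_GL[OF A(1)] and BG = Gamma_cong_GL[OF B(1)]
  have "A \<in> Gamma_cong n 2 #>\<^bsub>GL n\<^esub> B"
    using rcos_self[OF AG subgroup_Gamma_cong[of n 2]] eq quot_map_coset A B by simp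
  then obtain C where C: "C \<in> Gamma_cong n 2" "A = C \<otimes>\<^bsub>GL n\<^esub> B" by (auto simp: r_coset_def)
  then have "C = A \<otimes>\<^bsub>GL n\<^esub> inv\<^bsub>GL n\<^esub> B" using AG BG Gamma_cong_GL[OF C(1)] by (simp add: m_assoc)
  then have "C \<in> Gamma_cong n l"
    using A(1) B(1) subgroup.m_closed[OF subgroup_Gamma_cong] subgroup.m_inv_closed[OF subgroup_Gamma_cong]
    by simp
  then have "C \<in> Gamma_cong n (2 * l)" using C(1) Gamma_cong_Int[OF l] by blast
  then have "A \<in> Gamma_cong n (2 * l) #>\<^bsub>GL n\<^esub> B" using C(2) by (auto simp: r_coset_def)
  from repr_independence[OF this BG subgroup_Gamma_cong] show "X = Y" using A(2) B(2) by simp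
qed

text \<open>This coset is a preimage of \<open>sym_mod2 n (braid_perm n b)\<close>; by injectivity
  it is the one that \<open>inv_into\<close> selects.\<close>

lemma sym_incl_braid_perm:
  assumes l: "odd l" and b: "b \<in> braid_cong n l"
  shows "sym_incl n l (braid_perm n b) = Gamma_cong n (2 * l) #>\<^bsub>GL n\<^esub> burau n b"
proof -
  have bB: "b \<in> carrier (braid_group n)" using b by (simp add: braid_cong_def)
  have A: "burau n b \<in> Gamma_cong n l" using b burau_braid_cong by blast
  have "sym_mod2 n (braid_perm n b) = quot_map n (Gamma_cong n (2 * l) #>\<^bsub>GL n\<^esub> burau n b)"
    using sym_mod2_braid_perm[OF bB] quot_map_coset[OF A] by simp
  then show ?thesis
    unfolding sym_incl_def using inv_into_f_f[OF inj_on_quot_map[OF l]] A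
    by (auto simp: carrier_Gamma_quot)
qed

theorem theoremB:
  fixes n l :: nat
  assumes "n \<ge> 2" and "l \<ge> 1"
  shows "(even l \<or> n \<in> {2, 3} \<longrightarrow> burau n ` braid_cong n l = Gamma_cong n l) \<and>
    (n \<ge> 4 \<and> odd l \<longrightarrow>
      burau n ` braid_cong n l =
        {A \<in> Gamma_cong n l.
          Gamma_cong n (2 * l) #>\<^bsub>GL n\<^esub> A \<in> sym_incl n l ` carrier (sym_group n)})"
proof (intro conjI impI)
  assume "even l \<or> n \<in> {2, 3}"
  then have "odd_monomial n A" if "A \<in> Gamma_cong n l" for A
    using odd_monomial_cong_even[OF that] odd_monomial_small that by (auto simp: Gamma_cong_def)
  then have "Gamma_cong n l \<subseteq> burau_image n"
    using assms(1) by (auto simp: Gamma_cong_def intro: odd_monomial_in_image)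
  then show "burau n ` braid_cong n l = Gamma_cong n l" unfolding burau_braid_cong by blast
next
  assume "n \<ge> 4 \<and> odd l"
  then have l: "odd l" by simp
  have "A \<in> burau_image n \<longleftrightarrow>
      Gamma_cong n (2 * l) #>\<^bsub>GL n\<^esub> A \<in> sym_incl n l ` carrier (sym_group n)"
    if A: "A \<in> Gamma_cong n l" for A
  proof
    assume "A \<in> burau_image n"
    then obtain b where b: "b \<in> braid_cong n l" "A = burau n b"
      using A burau_braid_cong[of n l] by blast
    have "braid_perm n b \<in> carrier (sym_group n)"
      using b(1) hom_in_carrier[OF braid_perm_hom] by (simp add: braid_cong_def)
    then show "Gamma_cong n (2 * l) #>\<^bsub>GL n\<^esub> A \<in> sym_incl n l ` carrier (sym_group n)"
      using sym_incl_braid_perm[OF l b(1)] b(2) by (metis imageI)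
  next
    assume "Gamma_cong n (2 * l) #>\<^bsub>GL n\<^esub> A \<in> sym_incl n l ` carrier (sym_group n)"
    then obtain p where "p \<in> carrier (sym_group n)" "Gamma_cong n (2 * l) #>\<^bsub>GL n\<^esub> A = sym_incl n l p"
      by blast
    \<comment> \<open>The permutation is realized by a braid of level \<open>l\<close>, for which
      \<open>sym_incl\<close> is known.\<close>
    then obtain b where b: "b \<in> braid_cong n l"
      "Gamma_cong n (2 * l) #>\<^bsub>GL n\<^esub> A = Gamma_cong n (2 * l) #>\<^bsub>GL n\<^esub> burau n b"
      using braid_cong_perm_surj[OF l] sym_incl_braid_perm[OF l] by metis
    have "A \<in> Gamma_cong n (2 * l) #>\<^bsub>GL n\<^esub> burau n b"
      using group.rcos_self[OF GL_group Gamma_cong_GL[OF A] subgroup_Gamma_cong] b(2) by metis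
    then obtain C where C: "C \<in> Gamma_cong n (2 * l)" "A = C \<otimes>\<^bsub>GL n\<^esub> burau n b"
      by (auto simp: r_coset_def)
    \<comment> \<open>The level \<open>2 * l\<close> is even, so \<open>C\<close> is the identity
      modulo 2 and thus lies in the image.\<close>
    have "C \<in> burau_image n"
      using odd_monomial_cong_even[OF C(1)] C(1) assms(1)
      by (intro odd_monomial_in_image) (auto simp: Gamma_cong_def)
    moreover have "burau n b \<in> burau_image n" using b(1) burau_braid_cong[of n l] by blast
    ultimately show "A \<in> burau_image n"
      unfolding C(2) by (rule subgroup.m_closed[OF subgroup_burau_image])
  qed
  then show "burau n ` braid_cong n l =
      {A \<in> Gamma_cong n l. Gamma_cong n (2 * l) #>\<^bsub>GL n\<^esub> A \<in> sym_incl n l ` carrier (sym_group n)}"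
    unfolding burau_braid_cong by blast
qed

end
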